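(* The family of measures $\{\tilde{\hat\mu}_t\}_{t\in J}$ on $\widehat P$ is weakly continuous: if $t_i\to t_*$ in $J$ then $\int_{\widehat P}\alpha\,d\tilde{\hat\mu}_{t_i}\to\int_{\widehat P}\alpha\,d\tilde{\hat\mu}_{t_*}$ for every $\alpha\in C(\widehat P,\mathbb R)$.
   Context: Let $I=[-1,1]$, $J=(1,2]$, and for $t\in J$ let $f_t\colon I\to I$, $f_t(x)=\min\big(t(x-1)+3,\ t(1-x)-1\big)$ be the core tent map of slope $t$. Let $\mu_t$ be the unique absolutely continuous (with respect to Lebesgue) $f_t$-invariant Borel probability measure on $I$ (it is ergodic). It is known (Alves–Pumariño) that the densities of $\mu_t$ vary continuously in $L^1$, so $t\mapsto\mu_t$ is weakly continuous. For a compact metric space $X$ and continuous surjection $g\colon X\to X$, $\varprojlim(X,g)=\{\langle x_0,x_1,\dots\rangle\in X^{\mathbb N}: g(x_{n+1})=x_n\}$ with product topology, projections $\pi_n$, and natural extension $\hat g(\langle x_0,x_1,\dots\rangle)=\langle g(x_0),x_0,x_1,\dots\rangle$; each $g$-invariant Borel probability $\nu$ induces a unique $\hat g$-invariant Borel probability $\hat\nu$ with $(\pi_n)_*\hat\nu=\nu$ for all $n$. Let $\hat I_t=\varprojlim(I,f_t)$ and $\hat\mu_t$ the measure induced by $\mu_t$. Let $P=I\times J$, $F(x,t)=(f_t(x),t)$, $\widehat P=\varprojlim(P,F)$, and $\iota_t\colon\hat I_t\to\widehat P$, $\iota_t(\langle x_0,x_1,\dots\rangle)=\langle(x_0,t),(x_1,t),\dots\rangle$.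 Define $\tilde{\hat\mu}_t=(\iota_t)_*\hat\mu_t$. *)

theory Defs
  imports "HOL-Analysis.Analysis" "HOL-Probability.Probability"
begin

definition II :: "real set" where "II = {-1..1}"
definition JJ :: "real set" where "JJ = {1<..2}"

definition tent :: "real \<Rightarrow> real \<Rightarrow> real" where
  "tent t x = min (t * (x - 1) + 3) (t * (1 - x) - 1)"

definition invlim :: "'a set \<Rightarrow> ('a \<Rightarrow> 'a) \<Rightarrow> (nat \<Rightarrow> 'a) set" where
  "invlim X g = {x. (\<forall>n. x n \<in> X) \<and> (\<forall>n. g (x (Suc n)) = x n)}"

definition natext :: "('a \<Rightarrow> 'a) \<Rightarrow> (nat \<Rightarrow> 'a) \<Rightarrow> (nat \<Rightarrow> 'a)" where
  "natext g x = (\<lambda>n. case n of 0 \<Rightarrow> g (x 0) | Suc m \<Rightarrow> x m)"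

definition natext_measure ::
  "'a::topological_space set \<Rightarrow> ('a \<Rightarrow> 'a) \<Rightarrow> 'a measure \<Rightarrow> (nat \<Rightarrow> 'a) measure" where
  "natext_measure X g \<nu> = (THE N.
      prob_space N \<and>
      sets N = sets (restrict_space borel (invlim X g)) \<and>
      distr N (restrict_space borel (invlim X g)) (natext g) = N \<and>
      (\<forall>n. distr N (restrict_space borel X) (\<lambda>x. x n) = \<nu>))"

definition is_acim :: "real \<Rightarrow> real measure \<Rightarrow> bool" where
  "is_acim t \<mu> \<longleftrightarrow>
      prob_space \<mu> \<and>
      sets \<mu> = sets (restrict_space borel II) \<and>
      absolutely_continuous (restrict_space lborel II) \<mu> \<and>
      distr \<mu> (restrict_space borel II) (tent t) = \<mu>"

definition acim :: "real \<Rightarrow> real measure" where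
  "acim t = (THE \<mu>. is_acim t \<mu>)"

definition PP :: "(real \<times> real) set" where "PP = II \<times> JJ"

definition FF :: "real \<times> real \<Rightarrow> real \<times> real" where
  "FF p = (tent (snd p) (fst p), snd p)"

definition Phat :: "(nat \<Rightarrow> real \<times> real) set" where "Phat = invlim PP FF"

definition iota :: "real \<Rightarrow> (nat \<Rightarrow> real) \<Rightarrow> (nat \<Rightarrow> real \<times> real)" where
  "iota t x = (\<lambda>n. (x n, t))"

definition muhat_tilde :: "real \<Rightarrow> (nat \<Rightarrow> real \<times> real) measure" where
  "muhat_tilde t = distr (natext_measure II (tent t) (acim t)) (restrict_space borel Phat) (iota t)"

end

theory Submission
  imports Defs
begin

text \<open>
  Write \<open>f = tent t\<close> and \<open>E z \<phi>\<close> for the integral of \<open>\<phi>\<close> over \<open>[-1, z]\<close>.  By substitution,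
  \<open>E z (\<phi> \<circ> f)\<close> is a combination of \<open>E (f z) \<phi>\<close>, \<open>E 1 \<phi>\<close> and \<open>E (f (-1)) \<phi>\<close>.  Summing the signed
  series of \<open>E (f^n z) \<phi> / t^n\<close> (the signs being those of the derivatives of the iterates) therefore
  telescopes on coboundaries \<open>\<phi> - \<phi> \<circ> f\<close>, and applied to Birkhoff averages \<open>A_N \<phi>\<close> it gives
  \<open>E z (A_N \<phi>) = (z + 1) / 2 * E 1 (A_N \<phi>) + O(1 / N)\<close>.  Hence every absolutely continuous invariant
  probability integrates \<open>\<phi>\<close> to the limit of \<open>E 1 (A_N \<phi>) / 2\<close>, which gives uniqueness.  The series
  at \<open>z = 1\<close> is itself invariant with a bounded density; normalised, it is the invariant measure,
  and it is approximated by \<open>E 1 (A_N \<phi>) / 2\<close>, which is continuous in \<open>t\<close> for fixed \<open>N\<close>, with an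
  error \<open>O(1 / N)\<close> inversely proportional to its total mass.  The mass is bounded below locally
  uniformly in \<open>t\<close>: near \<open>1\<close> the density is at least one minus the sum of \<open>1 / t^n\<close> over the times
  \<open>n > 0\<close> at which \<open>1\<close> returns to itself, and these are multiples of some \<open>m\<close> with \<open>t^m \<ge> 3\<close>.

  An observable on the fat inverse limit depends, up to a uniformly small error over a compact set
  of parameters, only on the first \<open>n\<close> coordinates, which are functions of the \<open>n\<close>-th one; this
  reduces the claim to weak continuity of the invariant measures on the interval.
\<close>

section \<open>Tent maps and the kneading sequence\<close>

text \<open>The point where the two branches meet, at their common value 1, which is the maximum of
  \<open>tent t\<close>.\<close>

definition turn :: "real \<Rightarrow> real" where
  "turn t = 1 - 2 / t"

text \<open>The derivative of \<open>tent t\<close> is \<open>sg t * t\<close>; the value at the turning point is irrelevant.\<close>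

definition sg :: "real \<Rightarrow> real \<Rightarrow> real" where
  "sg t z = (if z < turn t then 1 else - 1)"

lemma JJ_D: assumes "t \<in> JJ" shows "1 < t" "t \<le> 2"
  using assms by (auto simp: JJ_def)

lemma abs_sg [simp]: "\<bar>sg t z\<bar> = 1"
  by (simp add: sg_def)

lemma tent_left:
  assumes "0 < t" "x \<le> turn t" shows "tent t x = t * (x - 1) + 3"
proof -
  have "t * x \<le> t * turn t" using assms by simp
  then show ?thesis using assms(1) by (simp add: tent_def turn_def algebra_simps min_def)
qed

lemma tent_right:
  assumes "0 < t" "turn t \<le> x" shows "tent t x = t * (1 - x) - 1"
proof -
  have "t * turn t \<le> t * x" using assms by simp
  then show ?thesis using assms(1) by (simp add: tent_def turn_def algebra_simps min_def)
qed

lemma tent_eq_sg: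
  assumes "0 < t" shows "tent t x = 1 + sg t x * t * (x - turn t)"
proof -
  have "t * turn t = t - 2" using assms by (simp add: turn_def algebra_simps)
  then show ?thesis using assms tent_left[of t x] tent_right[of t x]
    by (auto simp: sg_def algebra_simps)
qed

lemma tent_eq_1_iff:
  assumes "0 < t" shows "tent t x = 1 \<longleftrightarrow> x = turn t"
  using assms by (auto simp: tent_eq_sg sg_def)

lemma tent_at_1 [simp]: "t \<in> JJ \<Longrightarrow> tent t 1 = - 1"
  by (auto simp: tent_def JJ_def)

lemma turn_ge_m1: "t \<in> JJ \<Longrightarrow> - 1 \<le> turn t"
  by (simp add: turn_def JJ_def field_simps)

lemma tent_le_1: "0 < t \<Longrightarrow> tent t x \<le> 1"
  by (cases "x \<le> turn t") (auto simp: tent_left tent_right turn_def field_simps)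

lemma tent_in_II:
  assumes "t \<in> JJ" "x \<in> II" shows "tent t x \<in> II"
proof -
  have t: "1 < t" "t \<le> 2" using JJ_D[OF assms(1)] by auto
  have x: "- 1 \<le> x" "x \<le> 1" using assms by (auto simp: II_def)
  have "- 1 \<le> t * (x - 1) + 3"
  proof -
    have "t * (1 - x) \<le> 2 * 2" using t x by (intro mult_mono) auto
    then show ?thesis by (simp add: algebra_simps)
  qed
  moreover have "- 1 \<le> t * (1 - x) - 1" using t x by simp
  ultimately show ?thesis using tent_le_1[of t x] t by (auto simp: tent_def II_def)
qed

lemma funpow_in_II:
  assumes "t \<in> JJ" "x \<in> II" shows "(tent t ^^ n) x \<in> II"
  using assms by (induction n) (auto simp: tent_in_II)

lemma one_in_II [simp]: "1 \<in> II" and m1_in_II [simp]: "- 1 \<in> II"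
  by (auto simp: II_def)

section \<open>Expansion and affine pieces of the iterates\<close>

lemma tent_lipschitz:
  assumes "0 < t" shows "\<bar>tent t x - tent t y\<bar> \<le> t * \<bar>x - y\<bar>"
proof -
  have A: "\<bar>(t * (x - 1) + 3) - (t * (y - 1) + 3)\<bar> = t * \<bar>x - y\<bar>"
    using assms by (simp add: abs_mult flip: right_diff_distrib)
  have "(t * (1 - x) - 1) - (t * (1 - y) - 1) = t * (y - x)" by (simp add: algebra_simps)
  then have B: "\<bar>(t * (1 - x) - 1) - (t * (1 - y) - 1)\<bar> = t * \<bar>x - y\<bar>"
    using assms by (simp add: abs_mult)
  show ?thesis using A B unfolding tent_def by linarith
qed

lemma funpow_tent_lipschitz:
  assumes "0 < t" shows "\<bar>(tent t ^^ n) x - (tent t ^^ n) y\<bar> \<le> t ^ n * \<bar>x - y\<bar>"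
proof (induction n)
  case (Suc n)
  have "\<bar>(tent t ^^ Suc n) x - (tent t ^^ Suc n) y\<bar> \<le> t * \<bar>(tent t ^^ n) x - (tent t ^^ n) y\<bar>"
    using tent_lipschitz[OF assms] by simp
  also have "\<dots> \<le> t * (t ^ n * \<bar>x - y\<bar>)" using Suc assms by simp
  finally show ?case by simp
qed simp

text \<open>Induction on \<open>m\<close>: the previous iterate is affine on \<open>{x..y}\<close>
  and misses the turning point in the interior, so its image lies in a single branch, and one more
  step multiplies the slope by \<open>t\<close> or \<open>- t\<close>.\<close>

lemma funpow_tent_affine:
  assumes "0 < t" "x < y" "\<And>j w. j < m \<Longrightarrow> x < w \<Longrightarrow> w < y \<Longrightarrow> (tent t ^^ j) w \<noteq> turn t"
  shows "\<exists>s. \<bar>s\<bar> = (1::real) \<and> (\<forall>w\<in>{x..y}. (tent t ^^ m) w = (tent t ^^ m) x + s * t ^ m * (w - x))"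
  using assms(3)
proof (induction m)
  case 0
  then show ?case by (intro exI[of _ 1]) auto
next
  case (Suc m)
  let ?g = "tent t ^^ m"
  obtain s where s: "\<bar>s\<bar> = 1" "\<And>w. w \<in> {x..y} \<Longrightarrow> ?g w = ?g x + s * t ^ m * (w - x)"
    using Suc.IH Suc.prems less_SucI by (metis (no_types, lifting))
  have no: "?g w \<noteq> turn t" if "x < w" "w < y" for w using Suc.prems[of m w] that by simp
  have sides: "(\<forall>w\<in>{x..y}. ?g w \<le> turn t) \<or> (\<forall>w\<in>{x..y}. turn t \<le> ?g w)"
  proof (rule ccontr)
    assume "\<not> ?thesis"
    then obtain a b where ab: "a \<in> {x..y}" "b \<in> {x..y}" "turn t < ?g a" "?g b < turn t"
      by (auto simp: not_le)
    have ne: "s * t ^ m \<noteq> 0" using s(1) assms(1) by auto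
    \<comment> \<open>If the affine function \<open>?g\<close> took values on both sides of
      \<open>turn t\<close>, it would equal \<open>turn t\<close> at this point, which lies between
      \<open>a\<close> and \<open>b\<close> and hence strictly inside \<open>{x..y}\<close>.\<close>
    define w where "w = x + (turn t - ?g x) / (s * t ^ m)"
    have lin: "s * t ^ m * (w - x) = turn t - ?g x" using ne by (simp add: w_def)
    have "s * t ^ m * (a - x) > s * t ^ m * (w - x)" "s * t ^ m * (b - x) < s * t ^ m * (w - x)"
      using ab s(2)[of a] s(2)[of b] lin by auto
    then have "(a < w \<and> w < b) \<or> (b < w \<and> w < a)"
      using ne by (auto simp: mult_less_cancel_left)
    then have w: "x < w" "w < y" using ab by auto
    then have "?g w = turn t" using s(2)[of w] lin by simp
    then show False using no w by blast
  qed
  then show ?case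
  proof
    assume L: "\<forall>w\<in>{x..y}. ?g w \<le> turn t"
    show ?thesis
    proof (intro exI[of _ s] conjI ballI)
      fix w assume w: "w \<in> {x..y}"
      have "tent t (?g w) = t * (?g w - 1) + 3" "tent t (?g x) = t * (?g x - 1) + 3"
        using L w assms(1,2) by (auto simp: tent_left)
      moreover have "t * (?g w - 1) + 3 = t * (?g x - 1) + 3 + s * t ^ Suc m * (w - x)"
        unfolding s(2)[OF w] by (simp add: algebra_simps)
      ultimately show "(tent t ^^ Suc m) w = (tent t ^^ Suc m) x + s * t ^ Suc m * (w - x)"
        by (simp del: power_Suc)
    qed (fact s)
  next
    assume R: "\<forall>w\<in>{x..y}. turn t \<le> ?g w"
    show ?thesis
    proof (intro exI[of _ "- s"] conjI ballI)
      fix w assume w: "w \<in> {x..y}"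
      have "tent t (?g w) = t * (1 - ?g w) - 1" "tent t (?g x) = t * (1 - ?g x) - 1"
        using R w assms(1,2) by (auto simp: tent_right)
      moreover have "t * (1 - ?g w) - 1 = t * (1 - ?g x) - 1 + - s * t ^ Suc m * (w - x)"
        unfolding s(2)[OF w] by (simp add: algebra_simps)
      ultimately show "(tent t ^^ Suc m) w = (tent t ^^ Suc m) x + - s * t ^ Suc m * (w - x)"
        by (simp del: power_Suc)
    qed (use s in auto)
  qed
qed

lemma funpow_tent_expand:
  assumes "0 < t" "x < y" "\<And>j w. j < m \<Longrightarrow> x < w \<Longrightarrow> w < y \<Longrightarrow> (tent t ^^ j) w \<noteq> turn t"
  shows "\<bar>(tent t ^^ m) y - (tent t ^^ m) x\<bar> = t ^ m * (y - x)"
proof -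
  obtain s where s: "\<bar>s\<bar> = (1::real)"
    "\<And>w. w \<in> {x..y} \<Longrightarrow> (tent t ^^ m) w = (tent t ^^ m) x + s * t ^ m * (w - x)"
    using funpow_tent_affine[OF assms] by blast
  have "y \<in> {x..y}" using assms(2) by simp
  from s(2)[OF this] show ?thesis using s(1) assms(1,2) by (simp add: abs_mult)
qed

text \<open>The two inverse branches give at most two preimages of each point, so finiteness passes
  from \<open>j\<close> to \<open>Suc j\<close>.\<close>

lemma finite_funpow_tent_preimage:
  assumes "0 < t" shows "finite {x. (tent t ^^ j) x = y}"
proof (induction j)
  case (Suc j)
  have "{x. (tent t ^^ Suc j) x = y}
      \<subseteq> (\<lambda>z. 1 + (z - 3) / t) ` {z. (tent t ^^ j) z = y} \<union> (\<lambda>z. 1 - (z + 1) / t) ` {z. (tent t ^^ j) z = y}"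
  proof
    fix x assume "x \<in> {x. (tent t ^^ Suc j) x = y}"
    then have x: "(tent t ^^ j) (tent t x) = y" by (simp add: funpow_swap1)
    have "x = 1 + (tent t x - 3) / t \<or> x = 1 - (tent t x + 1) / t"
      using assms tent_left[of t x] tent_right[of t x] by (cases "x \<le> turn t") auto
    then show "x \<in> (\<lambda>z. 1 + (z - 3) / t) ` {z. (tent t ^^ j) z = y}
        \<union> (\<lambda>z. 1 - (z + 1) / t) ` {z. (tent t ^^ j) z = y}"
      using x by blast
  qed
  then show ?case using Suc finite_subset by blast
qed simp

text \<open>On the shortest gap between points of the periodic orbit, the \<open>m\<close>-th iterate fixes the end
  points, has a turning point inside, and its extremal values lie on the orbit.  Hence its
  variation, which is \<open>t ^ m\<close> times the length, is at least three times the length.\<close>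

lemma turning_point_period_expansion:
  assumes t: "t \<in> JJ" and m: "0 < m" and per: "(tent t ^^ m) 1 = 1"
  shows "3 \<le> t ^ m"
proof -
  have t1: "1 < t" "0 < t" using JJ_D[OF t] by auto
  let ?g = "tent t ^^ m"
  define O1 where "O1 = range (\<lambda>j. (tent t ^^ j) 1)"
  have fix_O: "?g p = p" if "p \<in> O1" for p
  proof -
    obtain j where "p = (tent t ^^ j) 1" using \<open>p \<in> O1\<close> by (auto simp: O1_def)
    then have "?g p = (tent t ^^ j) (?g 1)" by (metis add.commute comp_apply funpow_add)
    then show ?thesis using per \<open>p = _\<close> by simp
  qed
  have "O1 \<subseteq> (\<lambda>j. (tent t ^^ j) 1) ` {..<m}"
  proof
    fix p assume "p \<in> O1"
    then obtain j where "p = (tent t ^^ j) 1" by (auto simp: O1_def)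
    then have "p = (tent t ^^ (j mod m)) 1" using funpow_mod_eq[OF per] by simp
    then show "p \<in> (\<lambda>j. (tent t ^^ j) 1) ` {..<m}" using m by auto
  qed
  then have fin: "finite O1" by (rule finite_subset) simp
  \<comment> \<open>A point that meets the turning point before time \<open>m\<close> is sent to 1
    at the next step, so its \<open>m\<close>-th iterate lies on the orbit of 1.\<close>
  have turn_val: "?g w \<in> O1" if "j < m" "(tent t ^^ j) w = turn t" for j w
  proof -
    have "m = (m - Suc j) + Suc j" using that by simp
    then have "?g w = (tent t ^^ (m - Suc j)) ((tent t ^^ Suc j) w)"
      by (metis comp_apply funpow_add)
    also have "(tent t ^^ Suc j) w = 1" using that tent_eq_1_iff t1 by simp
    finally show ?thesis by (auto simp: O1_def)
  qed
  have "1 \<in> O1" "- 1 \<in> O1"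
    using t by (auto simp: O1_def intro: image_eqI[of _ _ 0] image_eqI[of _ _ 1])
  \<comment> \<open>The finite orbit contains both 1 and its image -1, so a smallest positive
    difference exists.\<close>
  define D where "D = (\<lambda>(p, q). q - p) ` {(p, q). p \<in> O1 \<and> q \<in> O1 \<and> p < q}"
  have "finite D" unfolding D_def
    by (intro finite_imageI finite_subset[OF _ finite_cartesian_product[OF fin fin]]) auto
  moreover have "1 - (- 1) \<in> D"
    unfolding D_def using \<open>1 \<in> O1\<close> \<open>- 1 \<in> O1\<close> by (intro image_eqI[of _ _ "(- 1, 1)"]) auto
  then have "D \<noteq> {}" by blast
  ultimately have "Min D \<in> D" and min_D: "\<And>d. d \<in> D \<Longrightarrow> Min D \<le> d" by auto
  then obtain p q where pq: "p \<in> O1" "q \<in> O1" "p < q" "q - p = Min D" by (auto simp: D_def)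
  have gap: "q - p \<le> \<bar>a - b\<bar>" if "a \<in> O1" "b \<in> O1" "a \<noteq> b" for a b
  proof -
    have "\<bar>a - b\<bar> \<in> D"
    proof (cases "a < b")
      case True
      then have "\<bar>a - b\<bar> = (\<lambda>(p, q). q - p) (a, b)" by simp
      then show ?thesis unfolding D_def using that True by blast
    next
      case False
      then have "\<bar>a - b\<bar> = (\<lambda>(p, q). q - p) (b, a)" by simp
      then show ?thesis unfolding D_def using that False by (intro image_eqI[of _ _ "(b, a)"]) auto
    qed
    then show ?thesis using min_D pq by simp
  qed
  \<comment> \<open>No orbit point lies strictly between the closest neighbours \<open>p\<close> and
    \<open>q\<close>. Any other one is outside, at distance at least \<open>q - p\<close> from the
    nearer of the two and hence at least twice that from the other.\<close>
  have far: "3 * (q - p) \<le> \<bar>v - p\<bar> + \<bar>q - v\<bar>" if "v \<in> O1" "v \<noteq> p" "v \<noteq> q" for v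
    using gap[of v p] gap[of v q] that pq by (cases "v < p"; cases "v > q"; simp)
  define T where "T = {w. p < w \<and> w < q \<and> (\<exists>j<m. (tent t ^^ j) w = turn t)}"
  have "T \<subseteq> (\<Union>j<m. {w. (tent t ^^ j) w = turn t})" by (auto simp: T_def)
  then have "finite T" by (rule finite_subset) (use finite_funpow_tent_preimage t1 in auto)
  \<comment> \<open>Without an interior turning point the factor \<open>t ^ m\<close> would stretch
    the whole gap, whose ends are fixed.\<close>
  have "T \<noteq> {}"
  proof
    assume "T = {}"
    then have "\<bar>?g q - ?g p\<bar> = t ^ m * (q - p)"
      using pq t1 by (intro funpow_tent_expand) (auto simp: T_def)
    then have "t ^ m = 1" using fix_O pq by simp
    then show False using one_less_power[OF t1(1) m] by simp
  qed
  define a where "a = Min T"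
  define b where "b = Max T"
  have ab: "a \<in> T" "b \<in> T" "a \<le> b" "\<And>w. w \<in> T \<Longrightarrow> a \<le> w \<and> w \<le> b"
    using \<open>finite T\<close> \<open>T \<noteq> {}\<close> by (auto simp: a_def b_def)
  have ab': "p < a" "a < q" "p < b" "b < q" "?g a \<in> O1" "?g b \<in> O1"
    using ab(1,2) turn_val by (auto simp: T_def)
  have ga: "\<bar>?g a - p\<bar> = t ^ m * (a - p)"
  proof -
    have "\<bar>?g a - ?g p\<bar> = t ^ m * (a - p)"
    proof (rule funpow_tent_expand)
      fix j w assume "j < m" "p < w" "w < a"
      then show "(tent t ^^ j) w \<noteq> turn t" using ab(4)[of w] ab' by (auto simp: T_def)
    qed (use t1 ab' in auto)
    then show ?thesis using fix_O pq by simp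
  qed
  have gb: "\<bar>q - ?g b\<bar> = t ^ m * (q - b)"
  proof -
    have "\<bar>?g q - ?g b\<bar> = t ^ m * (q - b)"
    proof (rule funpow_tent_expand)
      fix j w assume "j < m" "b < w" "w < q"
      then show "(tent t ^^ j) w \<noteq> turn t" using ab(4)[of w] ab' by (auto simp: T_def)
    qed (use t1 ab' in auto)
    then show ?thesis using fix_O pq by simp
  qed
  have pos: "0 < t ^ m" using t1 by simp
  have ne: "?g a \<noteq> p" "?g b \<noteq> q" using ga gb ab' pos t1 by auto
  \<comment> \<open>If \<open>?g a\<close> is not \<open>q\<close>, the detour from \<open>p\<close>
    to \<open>q\<close> via \<open>?g a\<close> already has length at least
    \<open>3 * (q - p)\<close>; symmetrically if \<open>?g b\<close> is not \<open>p\<close>.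
    Otherwise the values at \<open>p\<close>, \<open>a\<close>, \<open>b\<close>, \<open>q\<close>
    are \<open>p\<close>, \<open>q\<close>, \<open>p\<close>, \<open>q\<close>, and the gap is
    crossed three times.\<close>
  have "3 * (q - p) \<le> t ^ m * (q - p)"
  proof (cases "?g a = q")
    case False
    have "\<bar>?g q - ?g a\<bar> \<le> t ^ m * \<bar>q - a\<bar>" using funpow_tent_lipschitz t1 by blast
    then have "\<bar>q - ?g a\<bar> \<le> t ^ m * (q - a)" using fix_O pq ab' by simp
    then have "\<bar>?g a - p\<bar> + \<bar>q - ?g a\<bar> \<le> t ^ m * (q - p)" using ga by (simp add: algebra_simps)
    then show ?thesis using far[of "?g a"] ab' ne False by linarith
  next
    case True
    show ?thesis
    proof (cases "?g b = p")
      case False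
      have "\<bar>?g b - ?g p\<bar> \<le> t ^ m * \<bar>b - p\<bar>" using funpow_tent_lipschitz t1 by blast
      then have "\<bar>?g b - p\<bar> \<le> t ^ m * (b - p)" using fix_O pq ab' by simp
      then have "\<bar>?g b - p\<bar> + \<bar>q - ?g b\<bar> \<le> t ^ m * (q - p)" using gb by (simp add: algebra_simps)
      then show ?thesis using far[of "?g b"] ab' ne False by linarith
    next
      case bp: True
      have "\<bar>?g b - ?g a\<bar> \<le> t ^ m * \<bar>b - a\<bar>" using funpow_tent_lipschitz t1 by blast
      then have "q - p \<le> t ^ m * (b - a)" using True bp pq ab(3) by simp
      moreover have "q - p = t ^ m * (a - p)" "q - p = t ^ m * (q - b)"
        using ga gb True bp pq by auto
      ultimately have "3 * (q - p) \<le> t ^ m * (b - a) + t ^ m * (a - p) + t ^ m * (q - b)"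
        by (smt (verit))
      then show ?thesis by (simp add: algebra_simps)
    qed
  qed
  then show ?thesis using pq by simp
qed

section \<open>The signed kneading functional\<close>

text \<open>The bound \<open>M\<close> is explicit because the error terms have to be uniform in the
  observable and in the slope. It is imposed on the whole line so that composition with any Borel
  map keeps it.\<close>

definition bdd_borel :: "real \<Rightarrow> (real \<Rightarrow> real) \<Rightarrow> bool" where
  "bdd_borel M \<phi> \<longleftrightarrow> \<phi> \<in> borel_measurable borel \<and> (\<forall>x. \<bar>\<phi> x\<bar> \<le> M)"

definition intv :: "real \<Rightarrow> real \<Rightarrow> (real \<Rightarrow> real) \<Rightarrow> real" where
  "intv a b \<phi> = (\<integral>x. indicator {a..b} x * \<phi> x \<partial>lborel)"

definition birkhoff :: "real \<Rightarrow> nat \<Rightarrow> (real \<Rightarrow> real) \<Rightarrow> real \<Rightarrow> real" where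
  "birkhoff t N \<phi> x = (\<Sum>n<N. \<phi> ((tent t ^^ n) x)) / real N"

text \<open>Away from the turning points, \<open>ksign t z n * t ^ n\<close> is the derivative of
  the \<open>n\<close>-th iterate at \<open>z\<close>.\<close>

definition ksign :: "real \<Rightarrow> real \<Rightarrow> nat \<Rightarrow> real" where
  "ksign t z n = (\<Prod>j<n. sg t ((tent t ^^ j) z))"

text \<open>The weights are the reciprocals of the derivatives of the iterates at \<open>z\<close>.
  For \<open>z = 1\<close> this becomes the integral of \<open>\<phi>\<close> against the invariant
  density before normalisation.\<close>

definition kint :: "real \<Rightarrow> real \<Rightarrow> (real \<Rightarrow> real) \<Rightarrow> real" where
  "kint t z \<phi> = (\<Sum>n. ksign t z n / t ^ n * intv (- 1) ((tent t ^^ n) z) \<phi>)"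

text \<open>On functions of the form \<open>\<phi> - \<phi> \<circ> tent t\<close>, the series \<open>kint t z\<close> telescopes to \<open>kcob t z \<phi>\<close>.\<close>

definition kcob :: "real \<Rightarrow> real \<Rightarrow> (real \<Rightarrow> real) \<Rightarrow> real" where
  "kcob t z \<phi> = intv (- 1) z \<phi> - (1 - (t - 1) * (1 - z) / 2) * intv (- 1) 1 \<phi>
     + (1 - z) / 2 * intv (- 1) (3 - 2 * t) \<phi>"

section \<open>Bounded Borel observables and their integrals over intervals\<close>

lemma tent_measurable [measurable]: "tent t \<in> borel_measurable borel"
  unfolding tent_def[abs_def] by measurable

lemma funpow_tent_measurable [measurable]: "(tent t ^^ n) \<in> borel_measurable borel"
  by (induction n) (auto simp: comp_def intro: measurable_compose[OF _ tent_measurable])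

lemma bdd_borelD:
  assumes "bdd_borel M \<phi>" shows "\<phi> \<in> borel_measurable borel" "\<bar>\<phi> x\<bar> \<le> M"
  using assms by (auto simp: bdd_borel_def)

lemma bdd_borel_nonneg: "bdd_borel M \<phi> \<Longrightarrow> 0 \<le> M"
  using bdd_borelD(2)[of M \<phi> 0] by linarith

lemma bdd_borel_comp:
  assumes "bdd_borel M \<phi>" "f \<in> borel_measurable borel"
  shows "bdd_borel M (\<lambda>x. \<phi> (f x))"
  using assms by (auto simp: bdd_borel_def)

lemma bdd_borel_const: "bdd_borel \<bar>c\<bar> (\<lambda>_. c)"
  by (simp add: bdd_borel_def)

lemma bdd_borel_indicator: "B \<in> sets borel \<Longrightarrow> bdd_borel 1 (indicator B)"
  by (auto simp: bdd_borel_def indicator_def)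

lemma bdd_borel_add:
  assumes "bdd_borel M \<phi>" "bdd_borel K \<psi>" shows "bdd_borel (M + K) (\<lambda>x. \<phi> x + \<psi> x)"
  using assms by (auto simp: bdd_borel_def intro!: order.trans[OF abs_triangle_ineq] add_mono)

lemma bdd_borel_cmult:
  assumes "bdd_borel M \<phi>" shows "bdd_borel (\<bar>c\<bar> * M) (\<lambda>x. c * \<phi> x)"
  using assms by (auto simp: bdd_borel_def abs_mult intro!: mult_left_mono)

lemma bdd_borel_sum:
  fixes N :: nat
  assumes "\<And>n. bdd_borel M (\<phi> n)" shows "bdd_borel (real N * M) (\<lambda>x. \<Sum>n<N. \<phi> n x)"
proof (induction N)
  case (Suc N)
  show ?case using bdd_borel_add[OF Suc assms[of N]] by (simp add: algebra_simps)
qed (simp add: bdd_borel_def)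

lemma bdd_borel_birkhoff:
  assumes "bdd_borel M \<phi>" shows "bdd_borel M (birkhoff t N \<phi>)"
proof (cases "N = 0")
  case True
  then show ?thesis using bdd_borel_nonneg[OF assms] by (simp add: bdd_borel_def birkhoff_def[abs_def])
next
  case False
  have "bdd_borel (real N * M) (\<lambda>x. \<Sum>n<N. \<phi> ((tent t ^^ n) x))"
    by (intro bdd_borel_sum bdd_borel_comp[OF assms]) measurable
  from bdd_borel_cmult[OF this, of "1 / real N"] show ?thesis
    using False by (simp add: birkhoff_def[abs_def])
qed

lemma integrable_indicator_Icc: "integrable lborel (\<lambda>x. (M::real) * indicator {a..b::real} x)"
  by (rule integrable_mult_right, rule integrable_real_indicator) (simp_all add: emeasure_lborel_Icc_eq)

lemma intv_integrable:
  assumes "bdd_borel M \<phi>" shows "integrable lborel (\<lambda>x. indicator {a..b::real} x * \<phi> x)"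
proof (rule Bochner_Integration.integrable_bound)
  show "integrable lborel (\<lambda>x. M * indicator {a..b} x)" by (rule integrable_indicator_Icc)
  show "(\<lambda>x. indicator {a..b} x * \<phi> x) \<in> borel_measurable lborel"
    using bdd_borelD(1)[OF assms] by simp
  show "AE x in lborel. norm (indicator {a..b} x * \<phi> x) \<le> norm (M * indicator {a..b} x)"
    using bdd_borelD(2)[OF assms] by (intro AE_I2) (auto simp: indicator_def intro: order.trans[OF _ abs_ge_self])
qed

lemma intv_add:
  assumes "bdd_borel M \<phi>" "bdd_borel K \<psi>"
  shows "intv a b (\<lambda>x. \<phi> x + \<psi> x) = intv a b \<phi> + intv a b \<psi>"
  unfolding intv_def distrib_left
  using assms by (intro Bochner_Integration.integral_add) (rule intv_integrable, assumption)+

lemma intv_cmult: "intv a b (\<lambda>x. c * \<phi> x) = c * intv a b \<phi>"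
  unfolding intv_def by (simp add: mult.left_commute)

lemma intv_const: "a \<le> b \<Longrightarrow> intv a b (\<lambda>_. c) = c * (b - a)"
  unfolding intv_def by simp

lemma intv_bound:
  assumes "bdd_borel M \<phi>" "a \<le> b" shows "\<bar>intv a b \<phi>\<bar> \<le> M * (b - a)"
proof -
  have "\<bar>intv a b \<phi>\<bar> \<le> (\<integral>x. \<bar>indicator {a..b} x * \<phi> x\<bar> \<partial>lborel)"
    unfolding intv_def by (rule integral_abs_bound)
  also have "\<dots> \<le> (\<integral>x. M * indicator {a..b} x \<partial>lborel)"
  proof (rule integral_mono)
    show "integrable lborel (\<lambda>x. \<bar>indicator {a..b} x * \<phi> x\<bar>)"
      using intv_integrable[OF assms(1)] by (rule integrable_abs)
    next
    show "integrable lborel (\<lambda>x. M * indicator {a..b} x)" by (rule integrable_indicator_Icc)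
  qed (use bdd_borelD[OF assms(1)] in \<open>auto simp: indicator_def\<close>)
  also have "\<dots> = M * (b - a)" using assms by simp
  finally show ?thesis .
qed

lemma intv_split:
  assumes "bdd_borel M \<phi>" "a \<le> b" "b \<le> c" shows "intv a c \<phi> = intv a b \<phi> + intv b c \<phi>"
proof -
  have "intv a b \<phi> + intv b c \<phi> = (\<integral>x. indicator {a..b} x * \<phi> x + indicator {b..c} x * \<phi> x \<partial>lborel)"
    unfolding intv_def using intv_integrable[OF assms(1)] by simp
  also have "\<dots> = intv a c \<phi>" unfolding intv_def
  proof (rule integral_cong_AE)
    have "AE x in lborel. x \<noteq> b" by (rule AE_lborel_singleton)
    then show "AE x in lborel. indicator {a..b} x * \<phi> x + indicator {b..c} x * \<phi> x = indicator {a..c} x * \<phi> x"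
      by eventually_elim (use assms in \<open>auto simp: indicator_def\<close>)
  qed (use bdd_borelD(1)[OF assms(1)] in auto)
  finally show ?thesis by simp
qed

lemma II_bounds: "z \<in> II \<Longrightarrow> - 1 \<le> z" "z \<in> II \<Longrightarrow> z \<le> 1"
  by (auto simp: II_def)

lemma intv_m1_bound:
  assumes "bdd_borel M \<phi>" "z \<in> II" shows "\<bar>intv (- 1) z \<phi>\<bar> \<le> 2 * M"
proof -
  have "M * (z - - 1) \<le> M * 2"
    using bdd_borel_nonneg[OF assms(1)] II_bounds[OF assms(2)] by (intro mult_left_mono) auto
  then show ?thesis using intv_bound[OF assms(1), of "- 1" z] II_bounds[OF assms(2)] by simp
qed

context
  fixes t :: real assumes t: "t \<in> JJ"
begin

lemma t_bounds: "1 < t" "t \<le> 2" "0 < t"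
  using JJ_D[OF t] by auto

section \<open>Change of variables along the two branches\<close>

lemma intv_tent_left:
  assumes "b \<le> turn t"
  shows "intv a b (\<lambda>x. \<phi> (tent t x)) = intv (t * (a - 1) + 3) (t * (b - 1) + 3) \<phi> / t"
proof -
  have "intv (t * (a - 1) + 3) (t * (b - 1) + 3) \<phi> = \<bar>t\<bar> *\<^sub>R (\<integral>x. indicator {t * (a - 1) + 3..t * (b - 1) + 3} (3 - t + t * x) * \<phi> (3 - t + t * x) \<partial>lborel)"
    unfolding intv_def using t_bounds by (intro lborel_integral_real_affine) auto
  also have "(\<lambda>x. indicator {t * (a - 1) + 3..t * (b - 1) + 3} (3 - t + t * x) * \<phi> (3 - t + t * x))
      = (\<lambda>x. indicator {a..b} x * \<phi> (tent t x))"
  proof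
    fix x
    have "t * (a - 1) + 3 \<le> 3 - t + t * x \<longleftrightarrow> t * a \<le> t * x" by (auto simp: algebra_simps)
    moreover have "3 - t + t * x \<le> t * (b - 1) + 3 \<longleftrightarrow> t * x \<le> t * b" by (auto simp: algebra_simps)
    ultimately have "3 - t + t * x \<in> {t * (a - 1) + 3..t * (b - 1) + 3} \<longleftrightarrow> x \<in> {a..b}"
      using t_bounds by simp
    moreover have "3 - t + t * x = tent t x" if "x \<in> {a..b}"
      using that assms tent_left[of t x] t_bounds by (auto simp: algebra_simps)
    ultimately show "indicator {t * (a - 1) + 3..t * (b - 1) + 3} (3 - t + t * x) * \<phi> (3 - t + t * x)
      = indicator {a..b} x * \<phi> (tent t x)" by (auto simp: indicator_def)
  qed
  finally show ?thesis using t_bounds by (simp add: intv_def)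
qed

lemma intv_tent_right:
  assumes "turn t \<le> a"
  shows "intv a b (\<lambda>x. \<phi> (tent t x)) = intv (t * (1 - b) - 1) (t * (1 - a) - 1) \<phi> / t"
proof -
  have "intv (t * (1 - b) - 1) (t * (1 - a) - 1) \<phi> = \<bar>- t\<bar> *\<^sub>R (\<integral>x. indicator {t * (1 - b) - 1..t * (1 - a) - 1} (t - 1 + - t * x) * \<phi> (t - 1 + - t * x) \<partial>lborel)"
    unfolding intv_def using t_bounds by (intro lborel_integral_real_affine) auto
  also have "(\<lambda>x. indicator {t * (1 - b) - 1..t * (1 - a) - 1} (t - 1 + - t * x) * \<phi> (t - 1 + - t * x))
      = (\<lambda>x. indicator {a..b} x * \<phi> (tent t x))"
  proof
    fix x
    have "t * (1 - b) - 1 \<le> t - 1 + - t * x \<longleftrightarrow> t * x \<le> t * b" by (auto simp: algebra_simps)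
    moreover have "t - 1 + - t * x \<le> t * (1 - a) - 1 \<longleftrightarrow> t * a \<le> t * x" by (auto simp: algebra_simps)
    ultimately have "t - 1 + - t * x \<in> {t * (1 - b) - 1..t * (1 - a) - 1} \<longleftrightarrow> x \<in> {a..b}"
      using t_bounds by auto
    moreover have "t - 1 + - t * x = tent t x" if "x \<in> {a..b}"
      using that assms tent_right[of t x] t_bounds by (auto simp: algebra_simps)
    ultimately show "indicator {t * (1 - b) - 1..t * (1 - a) - 1} (t - 1 + - t * x) * \<phi> (t - 1 + - t * x)
      = indicator {a..b} x * \<phi> (tent t x)" by (auto simp: indicator_def)
  qed
  finally show ?thesis using t_bounds by (simp add: intv_def)
qed

text \<open>The left branch maps \<open>[-1, turn t]\<close> onto \<open>[3 - 2 * t, 1]\<close>, and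
  the right one maps \<open>[turn t, 1]\<close> onto \<open>[-1, 1]\<close> with reversed
  orientation. Beyond the turning point the integral therefore picks up the part over
  \<open>[tent t z, 1]\<close>, the complement of an initial interval, which produces both the sign
  and the total integral.\<close>

lemma intv_tent:
  assumes \<phi>: "bdd_borel M \<phi>" and z: "z \<in> II"
  shows "intv (- 1) z (\<lambda>x. \<phi> (tent t x)) =
    (sg t z * intv (- 1) (tent t z) \<phi> + (1 - sg t z) * intv (- 1) 1 \<phi> - intv (- 1) (3 - 2 * t) \<phi>) / t"
proof -
  have zz: "- 1 \<le> z" "z \<le> 1" using II_bounds z by auto
  have c: "- 1 \<le> turn t" using turn_ge_m1 t by blast
  have tc: "t * turn t = t - 2" using t_bounds by (simp add: turn_def algebra_simps)
  have eqs: "t * (- 1 - 1) + 3 = 3 - 2 * t" "t * (turn t - 1) + 3 = 1" "t * (1 - turn t) - 1 = 1"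
    using tc by (auto simp: algebra_simps)
  have tz: "- 1 \<le> tent t z" "tent t z \<le> 1" using tent_in_II[OF t z] II_bounds by auto
  show ?thesis
  proof (cases "z < turn t")
    case True
    have fz: "tent t z = t * (z - 1) + 3" using True t_bounds by (simp add: tent_left)
    have "t * (- 1) \<le> t * z" using zz t_bounds by (intro mult_left_mono) auto
    then have "3 - 2 * t \<le> tent t z" by (simp add: fz algebra_simps)
    then have "intv (- 1) (tent t z) \<phi> = intv (- 1) (3 - 2 * t) \<phi> + intv (3 - 2 * t) (tent t z) \<phi>"
      using t_bounds by (intro intv_split[OF \<phi>]) auto
    moreover have "intv (- 1) z (\<lambda>x. \<phi> (tent t x)) = intv (3 - 2 * t) (tent t z) \<phi> / t"
      using intv_tent_left[of z "- 1" \<phi>] True unfolding eqs fz by simp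
    ultimately show ?thesis using True by (simp add: sg_def)
  next
    case False
    have fz: "tent t z = t * (1 - z) - 1" using False t_bounds by (simp add: tent_right)
    have "intv (- 1) z (\<lambda>x. \<phi> (tent t x)) = intv (- 1) (turn t) (\<lambda>x. \<phi> (tent t x)) + intv (turn t) z (\<lambda>x. \<phi> (tent t x))"
      using False c by (intro intv_split[OF bdd_borel_comp[OF \<phi> tent_measurable]]) auto
    also have "\<dots> = (intv (3 - 2 * t) 1 \<phi> + intv (tent t z) 1 \<phi>) / t"
      using intv_tent_left[of "turn t" "- 1" \<phi>] intv_tent_right[of "turn t" z \<phi>]
      unfolding eqs fz by (simp add: add_divide_distrib)
    also have "intv (3 - 2 * t) 1 \<phi> = intv (- 1) 1 \<phi> - intv (- 1) (3 - 2 * t) \<phi>"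
      using intv_split[OF \<phi>, of "- 1" "3 - 2 * t" 1] t_bounds by simp
    also have "intv (tent t z) 1 \<phi> = intv (- 1) 1 \<phi> - intv (- 1) (tent t z) \<phi>"
      using intv_split[OF \<phi>, of "- 1" "tent t z" 1] tz by simp
    finally show ?thesis using False by (simp add: sg_def algebra_simps)
  qed
qed

section \<open>The signed series and its telescoping\<close>

lemma abs_ksign [simp]: "\<bar>ksign t z n\<bar> = 1"
  by (simp add: ksign_def abs_prod)

lemma inverse_powers_sums: "(\<lambda>n. B / t ^ n) sums (B * (t / (t - 1)))"
proof -
  have "(\<lambda>n. (1 / t) ^ n) sums (1 / (1 - 1 / t))"
    using t_bounds by (intro geometric_sums) simp
  moreover have "1 / (1 - 1 / t) = t / (t - 1)" using t_bounds by (simp add: field_simps)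
  ultimately have "(\<lambda>n. (1 / t) ^ n) sums (t / (t - 1))" by (simp only:)
  from sums_mult[OF this, of B] show ?thesis by (simp add: power_inverse divide_inverse)
qed

text \<open>Geometric domination by \<open>B / t ^ n\<close>. The factor \<open>t / (t - 1)\<close>
  is the sum of the powers of \<open>1 / t\<close>; it has to be kept bounded later, when the slope
  varies.\<close>

lemma kneading_series:
  assumes "\<And>n. \<bar>a n\<bar> \<le> B"
  shows "summable (\<lambda>n. ksign t z n / t ^ n * a n)"
    and "\<bar>\<Sum>n. ksign t z n / t ^ n * a n\<bar> \<le> B * (t / (t - 1))"
proof -
  have le: "norm (ksign t z n / t ^ n * a n) \<le> B / t ^ n" for n
    using assms[of n] t_bounds by (simp add: abs_mult divide_right_mono)
  show "summable (\<lambda>n. ksign t z n / t ^ n * a n)"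
    using summable_comparison_test'[OF sums_summable[OF inverse_powers_sums] le] .
  have "norm (\<Sum>n. ksign t z n / t ^ n * a n) \<le> (\<Sum>n. B / t ^ n)"
    using norm_suminf_le[OF le sums_summable[OF inverse_powers_sums]] .
  then show "\<bar>\<Sum>n. ksign t z n / t ^ n * a n\<bar> \<le> B * (t / (t - 1))"
    using sums_unique[OF inverse_powers_sums, of B] by simp
qed

lemma intv_orbit_bound:
  assumes "bdd_borel M \<phi>" "z \<in> II" shows "\<bar>intv (- 1) ((tent t ^^ n) z) \<phi>\<bar> \<le> 2 * M"
  using intv_m1_bound[OF assms(1)] funpow_in_II[OF t assms(2)] by blast

lemma kint_summable:
  assumes "bdd_borel M \<phi>" "z \<in> II"
  shows "summable (\<lambda>n. ksign t z n / t ^ n * intv (- 1) ((tent t ^^ n) z) \<phi>)"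
  by (rule kneading_series(1)[OF intv_orbit_bound[OF assms]])

lemma kint_bound:
  assumes "bdd_borel M \<phi>" "z \<in> II" shows "\<bar>kint t z \<phi>\<bar> \<le> 2 * M * (t / (t - 1))"
  unfolding kint_def by (rule kneading_series(2)[OF intv_orbit_bound[OF assms]])

lemma kint_add:
  assumes "bdd_borel M \<phi>" "bdd_borel K \<psi>" "z \<in> II"
  shows "kint t z (\<lambda>x. \<phi> x + \<psi> x) = kint t z \<phi> + kint t z \<psi>"
  unfolding kint_def intv_add[OF assms(1,2)] distrib_left
  by (rule suminf_add[symmetric]) (rule kint_summable[OF _ assms(3)], fact)+

lemma kint_cmult:
  assumes "bdd_borel M \<phi>" "z \<in> II"
  shows "kint t z (\<lambda>x. c * \<phi> x) = c * kint t z \<phi>"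
  unfolding kint_def intv_cmult mult.left_commute[of _ c]
  by (rule suminf_mult[OF kint_summable[OF assms]])

lemma kint_diff:
  assumes "bdd_borel M \<phi>" "bdd_borel K \<psi>" "z \<in> II"
  shows "kint t z (\<lambda>x. \<phi> x - \<psi> x) = kint t z \<phi> - kint t z \<psi>"
  using kint_add[OF assms(1) bdd_borel_cmult[OF assms(2), of "- 1"] assms(3)]
    kint_cmult[OF assms(2,3), of "- 1"] by simp

lemma kint_sum:
  fixes N :: nat
  assumes "\<And>n. bdd_borel M (\<phi> n)" "z \<in> II"
  shows "kint t z (\<lambda>x. \<Sum>n<N. \<phi> n x) = (\<Sum>n<N. kint t z (\<phi> n))"
proof (induction N)
  case 0
  then show ?case by (simp add: kint_def intv_def)
next
  case (Suc N)
  then show ?case using kint_add[OF bdd_borel_sum[of M \<phi> N] assms(1)[of N] assms(2)] assms(1) by simp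
qed

text \<open>Put \<open>b z = (1 - z) / 2\<close>. Then
  \<open>b z - sg t z / t * b (tent t z) = 1 / t\<close>, as \<open>tent t\<close> is piecewise
  affine. The coefficients \<open>1 - (t - 1) * b z\<close> and \<open>b z\<close> in
  \<open>kcob\<close> are chosen so that this identity reproduces the contributions of the total
  integral and of \<open>3 - 2 * t\<close> in \<open>intv_tent\<close>.\<close>

lemma kcob_step:
  assumes "bdd_borel M \<phi>" "z \<in> II"
  shows "intv (- 1) z \<phi> - intv (- 1) z (\<lambda>x. \<phi> (tent t x)) = kcob t z \<phi> - sg t z / t * kcob t (tent t z) \<phi>"
proof -
  define s where "s = sg t z"
  define A B C D where "A = intv (- 1) z \<phi>" "B = intv (- 1) (tent t z) \<phi>" "C = intv (- 1) 1 \<phi>"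
    "D = intv (- 1) (3 - 2 * t) \<phi>"
  have ss: "s * s = 1" by (auto simp: s_def sg_def)
  have w: "1 - tent t z = - (s * (t * z - t + 2))"
    using tent_eq_sg[of t z] t_bounds by (simp add: s_def turn_def algebra_simps)
  \<comment> \<open>Multiplying by \<open>s\<close> removes the sign, as \<open>s * s = 1\<close>;
    what remains is affine in \<open>z\<close>.\<close>
  have 1: "s * (1 - tent t z) = - (t * z - t + 2)"
  proof -
    have "s * (1 - tent t z) = - (s * s) * (t * z - t + 2)" unfolding w by simp
    then show ?thesis by (simp only: ss) simp
  qed
  have 2: "intv (- 1) z (\<lambda>x. \<phi> (tent t x)) = (s * B + (1 - s) * C - D) / t"
    using intv_tent[OF assms] by (simp add: s_def A_B_C_D_def)
  have "t * (kcob t z \<phi> - s / t * kcob t (tent t z) \<phi>) =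
      t * A - t * C + t * (t - 1) * (1 - z) / 2 * C + t * (1 - z) / 2 * D
      - s * B + s * C - (t - 1) * (s * (1 - tent t z)) / 2 * C - (s * (1 - tent t z)) / 2 * D"
  proof -
    have k: "kcob t z \<phi> = A - (1 - (t - 1) * (1 - z) / 2) * C + (1 - z) / 2 * D"
      "kcob t (tent t z) \<phi> = B - (1 - (t - 1) * (1 - tent t z) / 2) * C + (1 - tent t z) / 2 * D"
      by (simp_all only: kcob_def A_B_C_D_def)
    have "t * (kcob t z \<phi> - s / t * kcob t (tent t z) \<phi>) = t * kcob t z \<phi> - s * kcob t (tent t z) \<phi>"
      using t_bounds by (simp add: right_diff_distrib)
    then show ?thesis unfolding k by (simp add: field_simps)
  qed
  also have "\<dots> = t * A - (s * B + (1 - s) * C - D)"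
    unfolding 1 by (simp add: field_simps)
  also have "\<dots> = t * (A - (s * B + (1 - s) * C - D) / t)" using t_bounds by (simp add: field_simps)
  finally show ?thesis using t_bounds by (simp add: 2 s_def A_B_C_D_def)
qed

lemma kcob_bound:
  assumes "bdd_borel M \<phi>" "z \<in> II" shows "\<bar>kcob t z \<phi>\<bar> \<le> 6 * M"
proof -
  have z: "- 1 \<le> z" "z \<le> 1" using II_bounds assms by auto
  define l where "l = (1 - z) / 2"
  have l: "0 \<le> l" "l \<le> 1" using z by (auto simp: l_def)
  have k: "0 \<le> (t - 1) * l" "(t - 1) * l \<le> 1"
    using l t_bounds mult_mono[of "t - 1" 1 l 1] by auto
  have m: "3 - 2 * t \<in> II" using t_bounds by (auto simp: II_def)
  have "\<bar>(1 - (t - 1) * l) * intv (- 1) 1 \<phi>\<bar> \<le> 1 * (2 * M)"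
    unfolding abs_mult using k intv_m1_bound[OF assms(1), of 1] by (intro mult_mono) auto
  moreover have "\<bar>l * intv (- 1) (3 - 2 * t) \<phi>\<bar> \<le> 1 * (2 * M)"
    unfolding abs_mult using l intv_m1_bound[OF assms(1) m] by (intro mult_mono) auto
  moreover have "kcob t z \<phi> = intv (- 1) z \<phi> - (1 - (t - 1) * l) * intv (- 1) 1 \<phi> + l * intv (- 1) (3 - 2 * t) \<phi>"
    by (simp add: kcob_def l_def)
  ultimately show ?thesis using intv_m1_bound[OF assms] by linarith
qed

text \<open>By \<open>kcob_step\<close> at the \<open>n\<close>-th point of the orbit, the
  \<open>n\<close>-th term of the difference is \<open>a n - a (Suc n)\<close>. Since
  \<open>a\<close> tends to 0, only \<open>a 0\<close> remains.\<close>

lemma kint_coboundary: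
  assumes "bdd_borel M \<phi>" "z \<in> II"
  shows "kint t z \<phi> - kint t z (\<lambda>x. \<phi> (tent t x)) = kcob t z \<phi>"
proof -
  let ?o = "\<lambda>n. (tent t ^^ n) z"
  define a where "a n = ksign t z n / t ^ n * kcob t (?o n) \<phi>" for n
  have "summable a" unfolding a_def
    using kcob_bound[OF assms(1) funpow_in_II[OF t assms(2)]] by (rule kneading_series(1))
  then have "a \<longlonglongrightarrow> 0" by (rule summable_LIMSEQ_zero)
  then have sums: "(\<lambda>n. a n - a (Suc n)) sums (a 0)" using telescope_sums'[of a 0] by simp
  have step: "a n - a (Suc n) = ksign t z n / t ^ n * intv (- 1) (?o n) \<phi>
      - ksign t z n / t ^ n * intv (- 1) (?o n) (\<lambda>x. \<phi> (tent t x))" for n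
    unfolding right_diff_distrib[symmetric] kcob_step[OF assms(1) funpow_in_II[OF t assms(2)]]
    by (simp add: a_def ksign_def right_diff_distrib mult_ac)
  have "kint t z \<phi> - kint t z (\<lambda>x. \<phi> (tent t x)) = (\<Sum>n. a n - a (Suc n))"
    unfolding step kint_def
    by (rule suminf_diff[OF kint_summable[OF assms] kint_summable[OF bdd_borel_comp[OF assms(1) tent_measurable] assms(2)]])
  also have "\<dots> = a 0" using sums by (rule sums_unique[symmetric])
  finally show ?thesis by (simp add: a_def ksign_def)
qed

section \<open>Birkhoff averages under the signed functional\<close>

lemma birkhoff_diff:
  assumes "bdd_borel M \<phi>"
  shows "bdd_borel (2 * M / real N) (\<lambda>x. birkhoff t N \<phi> x - birkhoff t N \<phi> (tent t x))"
proof -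
  \<comment> \<open>The averages at \<open>x\<close> and at \<open>tent t x\<close> share all terms
    but the first of the one and the last of the other.\<close>
  have eq: "birkhoff t N \<phi> x - birkhoff t N \<phi> (tent t x) = (\<phi> x - \<phi> ((tent t ^^ N) x)) / real N" for x
  proof -
    have "(\<Sum>n<N. \<phi> ((tent t ^^ n) x)) - (\<Sum>n<N. \<phi> ((tent t ^^ n) (tent t x)))
        = (\<Sum>n<N. \<phi> ((tent t ^^ n) x) - \<phi> ((tent t ^^ Suc n) x))"
      by (simp add: sum_subtractf funpow_swap1)
    also have "\<dots> = \<phi> x - \<phi> ((tent t ^^ N) x)"
      using sum_lessThan_telescope'[of "\<lambda>n. \<phi> ((tent t ^^ n) x)" N] by simp
    finally show ?thesis unfolding birkhoff_def diff_divide_distrib[symmetric] by simp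
  qed
  have "\<bar>(\<phi> x - \<phi> ((tent t ^^ N) x)) / real N\<bar> \<le> 2 * M / real N" for x
    using bdd_borelD(2)[OF assms, of x] bdd_borelD(2)[OF assms, of "(tent t ^^ N) x"]
    by (simp add: divide_right_mono)
  then show ?thesis unfolding eq bdd_borel_def
    using bdd_borelD(1)[OF assms] by (auto intro!: measurable_compose[OF funpow_tent_measurable])
qed

text \<open>By \<open>kint_coboundary\<close> this is \<open>kint\<close> of the average minus its
  composition with \<open>tent t\<close>, a function of size at most \<open>2 * M / N\<close> by
  \<open>birkhoff_diff\<close>.\<close>

lemma kcob_birkhoff_bound:
  assumes "bdd_borel M \<phi>" "z \<in> II"
  shows "\<bar>kcob t z (birkhoff t N \<phi>)\<bar> \<le> 4 * M / real N * (t / (t - 1))"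
proof -
  let ?A = "birkhoff t N \<phi>"
  have A: "bdd_borel M ?A" by (rule bdd_borel_birkhoff[OF assms(1)])
  have "kcob t z ?A = kint t z (\<lambda>x. ?A x - ?A (tent t x))"
    using kint_coboundary[OF A assms(2)] kint_diff[OF A bdd_borel_comp[OF A tent_measurable] assms(2)] by simp
  then show ?thesis using kint_bound[OF birkhoff_diff[OF assms(1)] assms(2), of N] by simp
qed

text \<open>Eliminating \<open>intv (- 1) (3 - 2 * t)\<close> from the two equations \<open>kcob t z\<close> and
  \<open>kcob t (3 - 2 * t)\<close> compares the integral over any initial interval with the total integral.\<close>

lemma intv_birkhoff_equidistributed:
  assumes "bdd_borel M \<phi>" "z \<in> II"
  shows "\<bar>intv (- 1) z (birkhoff t N \<phi>) - (z + 1) / 2 * intv (- 1) 1 (birkhoff t N \<phi>)\<bar>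
    \<le> 8 * M / real N * (t / (t - 1))"
proof -
  let ?A = "birkhoff t N \<phi>"
  let ?B = "4 * M / real N * (t / (t - 1))"
  have z: "- 1 \<le> z" "z \<le> 1" using II_bounds assms by auto
  have m: "3 - 2 * t \<in> II" using t_bounds by (auto simp: II_def)
  have eq: "intv (- 1) z ?A - (z + 1) / 2 * intv (- 1) 1 ?A
      = kcob t z ?A - (1 - z) / (2 * t) * kcob t (3 - 2 * t) ?A"
  proof -
    define I3 I1 where "I3 = intv (- 1) (3 - 2 * t) ?A" "I1 = intv (- 1) 1 ?A"
    \<comment> \<open>At \<open>z = 3 - 2 * t\<close> the coefficient \<open>(1 - z) / 2\<close>
      equals \<open>t - 1\<close>, so the two occurrences of \<open>I3\<close> combine to
      \<open>t * I3\<close>.\<close>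
    have 1: "kcob t (3 - 2 * t) ?A = t * (I3 - (2 - t) * I1)"
      by (simp add: kcob_def I3_I1_def[symmetric]) (simp add: field_simps)
    have "(1 - z) / (2 * t) * kcob t (3 - 2 * t) ?A = (1 - z) / 2 * (I3 - (2 - t) * I1)"
      unfolding 1 using t_bounds by simp
    then show ?thesis by (simp only: kcob_def I3_I1_def[symmetric]) (simp add: field_simps)
  qed
  have "\<bar>(1 - z) / (2 * t) * kcob t (3 - 2 * t) ?A\<bar> \<le> 1 * ?B"
    unfolding abs_mult using z t_bounds kcob_birkhoff_bound[OF assms(1) m]
    by (intro mult_mono) auto
  then show ?thesis unfolding eq using kcob_birkhoff_bound[OF assms, of N] by linarith
qed

text \<open>At the end point \<open>z = 1\<close> the coefficients of \<open>kcob\<close> become 1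
  and 0, and its first two terms cancel; the coboundary formula then reads as invariance.\<close>

lemma kint_1_invariant:
  assumes "bdd_borel M \<phi>" shows "kint t 1 (\<lambda>x. \<phi> (tent t x)) = kint t 1 \<phi>"
  using kint_coboundary[OF assms, of 1] by (simp add: kcob_def)

lemma kint_1_birkhoff:
  assumes "bdd_borel M \<phi>" "0 < N" shows "kint t 1 (birkhoff t N \<phi>) = kint t 1 \<phi>"
proof -
  have pow: "kint t 1 (\<lambda>x. \<phi> ((tent t ^^ n) x)) = kint t 1 \<phi>" for n
  proof (induction n)
    case (Suc n)
    have "kint t 1 (\<lambda>x. \<phi> ((tent t ^^ n) (tent t x))) = kint t 1 (\<lambda>x. \<phi> ((tent t ^^ n) x))"
      by (rule kint_1_invariant[OF bdd_borel_comp[OF assms(1)]]) measurable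
    then show ?case using Suc by (simp add: funpow_swap1)
  qed simp
  have bb: "bdd_borel M (\<lambda>x. \<phi> ((tent t ^^ n) x))" for n
    by (rule bdd_borel_comp[OF assms(1)]) measurable
  have "kint t 1 (birkhoff t N \<phi>) = kint t 1 (\<lambda>x. 1 / real N * (\<Sum>n<N. \<phi> ((tent t ^^ n) x)))"
    by (simp add: birkhoff_def[abs_def])
  also have "\<dots> = 1 / real N * (\<Sum>n<N. kint t 1 (\<lambda>x. \<phi> ((tent t ^^ n) x)))"
    by (subst kint_cmult[OF bdd_borel_sum[OF bb]]) (simp_all add: kint_sum[OF bb])
  also have "\<dots> = kint t 1 \<phi>" using assms(2) by (simp add: pow)
  finally show ?thesis .
qed

text \<open>Passing to the Birkhoff average does not change \<open>kint t 1\<close>. In each term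
  the integral over \<open>[-1, z]\<close> is then nearly \<open>(z + 1) / 2\<close> times the
  total, and the signed weights \<open>z + 1\<close> sum to the value of \<open>kint t 1\<close> on
  the constant 1. Summing the errors by \<open>kneading_series\<close> gives the second factor
  \<open>t / (t - 1)\<close>.\<close>

lemma kint_1_mix:
  assumes \<phi>: "bdd_borel M \<phi>" and N: "0 < N"
  shows "\<bar>kint t 1 \<phi> - kint t 1 (\<lambda>_. 1) / 2 * intv (- 1) 1 (birkhoff t N \<phi>)\<bar> \<le> 8 * M / real N * (t / (t - 1))\<^sup>2"
proof -
  let ?A = "birkhoff t N \<phi>"
  let ?o = "\<lambda>n. (tent t ^^ n) 1"
  have A: "bdd_borel M ?A" by (rule bdd_borel_birkhoff[OF \<phi>])
  have one: "intv (- 1) (?o n) (\<lambda>_. 1) = ?o n + 1" for n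
    using II_bounds[OF funpow_in_II[OF t one_in_II, of n]] by (simp add: intv_const)
  have sA: "summable (\<lambda>n. ksign t 1 n / t ^ n * intv (- 1) (?o n) ?A)"
    by (rule kint_summable[OF A]) simp
  have s1: "summable (\<lambda>n. ksign t 1 n / t ^ n * (?o n + 1))"
    using kint_summable[OF bdd_borel_const[of 1], of 1] by (simp add: one)
  have "kint t 1 (\<lambda>_. 1) / 2 * intv (- 1) 1 ?A = (\<Sum>n. ksign t 1 n / t ^ n * (?o n + 1) * (intv (- 1) 1 ?A / 2))"
    using suminf_mult2[OF s1, of "intv (- 1) 1 ?A / 2"] by (simp add: kint_def one)
  then have "kint t 1 \<phi> - kint t 1 (\<lambda>_. 1) / 2 * intv (- 1) 1 ?A
     = (\<Sum>n. ksign t 1 n / t ^ n * intv (- 1) (?o n) ?A) - (\<Sum>n. ksign t 1 n / t ^ n * (?o n + 1) * (intv (- 1) 1 ?A / 2))"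
    using kint_1_birkhoff[OF assms] by (simp add: kint_def)
  also have "\<dots> = (\<Sum>n. ksign t 1 n / t ^ n * intv (- 1) (?o n) ?A - ksign t 1 n / t ^ n * (?o n + 1) * (intv (- 1) 1 ?A / 2))"
    by (rule suminf_diff[OF sA summable_mult2[OF s1]])
  also have "\<dots> = (\<Sum>n. ksign t 1 n / t ^ n * (intv (- 1) (?o n) ?A - (?o n + 1) / 2 * intv (- 1) 1 ?A))"
    by (simp add: right_diff_distrib mult.assoc)
  also have "\<bar>\<dots>\<bar> \<le> 8 * M / real N * (t / (t - 1)) * (t / (t - 1))"
    by (intro kneading_series(2) intv_birkhoff_equidistributed[OF \<phi>] funpow_in_II[OF t]) simp
  finally show ?thesis by (simp only: power2_eq_square mult.assoc)
qed

end

section \<open>A locally uniform lower bound for the total mass\<close>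

lemma tendsto_funpow_tent:
  assumes "(\<tau> \<longlongrightarrow> t) F" "(\<xi> \<longlongrightarrow> x) F"
  shows "((\<lambda>i. (tent (\<tau> i) ^^ n) (\<xi> i)) \<longlongrightarrow> (tent t ^^ n) x) F"
proof (induction n)
  case (Suc n)
  then show ?case unfolding funpow.simps comp_apply tent_def
    by (intro tendsto_intros assms)
qed (simp add: assms)

text \<open>If 1 is periodic, \<open>m\<close> is its least period and
  \<open>turning_point_period_expansion\<close> applies. Otherwise \<open>n = 0\<close> is the only
  return, and any \<open>m\<close> with \<open>3 < t ^ m\<close> serves.\<close>

lemma exists_expanding_return:
  assumes t: "t \<in> JJ"
  obtains m where "0 < m" "3 \<le> t ^ m" "\<And>n. (tent t ^^ n) 1 = 1 \<Longrightarrow> m dvd n"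
proof (cases "\<exists>n>0. (tent t ^^ n) 1 = 1")
  case True
  define m where "m = (LEAST n. 0 < n \<and> (tent t ^^ n) 1 = 1)"
  have m: "0 < m" "(tent t ^^ m) 1 = 1"
    using LeastI_ex[OF True] by (auto simp: m_def)
  have "m dvd n" if "(tent t ^^ n) 1 = 1" for n
  proof (rule ccontr)
    assume "\<not> m dvd n"
    then have "0 < n mod m" by (simp add: dvd_eq_mod_eq_0)
    moreover have "(tent t ^^ (n mod m)) 1 = 1" using that funpow_mod_eq[OF m(2)] by simp
    ultimately have "m \<le> n mod m" unfolding m_def by (intro Least_le) auto
    then show False using mod_less_divisor[OF m(1), of n] by linarith
  qed
  then show ?thesis using that m turning_point_period_expansion[OF t m] by blast
next
  case False
  obtain m where "3 < t ^ m" using real_arch_pow JJ_D[OF t] by blast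
  moreover have "0 < m" using \<open>3 < t ^ m\<close> by (cases m) auto
  moreover have "m dvd n" if "(tent t ^^ n) 1 = 1" for n
    using False that by (cases n) auto
  ultimately show ?thesis using that by (metis less_imp_le)
qed

text \<open>Used to keep \<open>t / (t - 1)\<close> bounded near \<open>t0\<close>.\<close>

lemma JJ_neighbourhood:
  assumes "t0 \<in> JJ"
  obtains r where "1 < r" "\<forall>\<^sub>F t in nhds t0. r < t"
proof
  show "1 < (1 + t0) / 2" using JJ_D[OF assms] by simp
  have "(1 + t0) / 2 < t0" using JJ_D[OF assms] by simp
  then show "\<forall>\<^sub>F t in nhds t0. (1 + t0) / 2 < t"
    by (rule order_tendstoD(1)[OF filterlim_ident])
qed

lemma indicator_Icc_tail:
  assumes "0 < \<eta>" "\<eta> \<le> 2" "z \<in> II"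
  shows "0 \<le> intv (- 1) z (indicator {1 - \<eta>..1})" "intv (- 1) z (indicator {1 - \<eta>..1}) \<le> \<eta>"
    "z < 1 - \<eta> \<Longrightarrow> intv (- 1) z (indicator {1 - \<eta>..1}) = 0"
    "intv (- 1) 1 (indicator {1 - \<eta>..1}) = \<eta>"
proof -
  have eq: "intv (- 1) w (indicator {1 - \<eta>..1}) = measure lborel {1 - \<eta>..w}" if "w \<in> II" for w
  proof -
    have "(\<lambda>x. indicator {- 1..w} x * indicator {1 - \<eta>..1} x) = (indicator {1 - \<eta>..w} :: real \<Rightarrow> real)"
      using assms that by (auto simp: indicator_def II_def)
    then show ?thesis unfolding intv_def by (simp only: integral_indicator) simp
  qed
  show "0 \<le> intv (- 1) z (indicator {1 - \<eta>..1})" "intv (- 1) z (indicator {1 - \<eta>..1}) \<le> \<eta>"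
    "z < 1 - \<eta> \<Longrightarrow> intv (- 1) z (indicator {1 - \<eta>..1}) = 0"
    using assms by (auto simp: eq II_def)
  show "intv (- 1) 1 (indicator {1 - \<eta>..1}) = \<eta>" using assms by (simp add: eq)
qed

lemma sums_multiples:
  fixes t :: real
  assumes "1 < t ^ m" "0 < m"
  shows "(\<lambda>n. if m dvd n then 1 / t ^ n else 0) sums (1 / (1 - 1 / t ^ m))"
proof (subst sums_mono_reindex[of "\<lambda>k. m * k", symmetric])
  show "strict_mono (\<lambda>k. m * k)" using assms by (auto simp: strict_mono_def)
  show "(if m dvd n then 1 / t ^ n else 0) = 0" if "n \<notin> range (\<lambda>k. m * k)" for n
    using that by (auto elim!: dvdE)
  have "(\<lambda>k. (1 / t ^ m) ^ k) sums (1 / (1 - 1 / t ^ m))"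
    using assms by (intro geometric_sums) simp
  then show "(\<lambda>k. if m dvd m * k then 1 / t ^ (m * k) else 0) sums (1 / (1 - 1 / t ^ m))"
    by (simp add: power_divide power_mult)
qed

lemma sums_tail:
  assumes "t \<in> JJ"
  shows "(\<lambda>n. if N \<le> n then 1 / t ^ n else 0) sums (1 / t ^ N * (t / (t - 1)))"
proof (subst sums_mono_reindex[of "\<lambda>k. N + k", symmetric])
  show "strict_mono (\<lambda>k. N + k)" by (auto simp: strict_mono_def)
  show "(if N \<le> n then 1 / t ^ n else 0) = 0" if "n \<notin> range (\<lambda>k. N + k)" for n
    using that by (auto dest: le_Suc_ex)
  show "(\<lambda>k. if N \<le> N + k then 1 / t ^ (N + k) else 0) sums (1 / t ^ N * (t / (t - 1)))"
    using inverse_powers_sums[OF assms, of "1 / t ^ N"] by (simp add: power_add)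
qed

text \<open>The term \<open>n = 0\<close> contributes \<open>\<eta>\<close>. Before time
  \<open>N\<close>, the terms at times not divisible by \<open>m\<close> vanish, since the orbit of
  1 then misses the window; all others have size at most \<open>\<eta> / t ^ n\<close>. The
  multiples of \<open>m\<close>, with 0 included, add up to at most \<open>5 / 3 * \<eta>\<close>
  and the tail to at most \<open>\<eta> / 6\<close>, too little to cancel the first term.\<close>

lemma kint_indicator_lower:
  assumes t: "t \<in> JJ" and \<eta>: "0 < \<eta>" "\<eta> \<le> 2" and m: "0 < m" "5 / 2 \<le> t ^ m"
    and N: "1 / t ^ N * (t / (t - 1)) \<le> 1 / 6"
    and away: "\<And>n. n < N \<Longrightarrow> \<not> m dvd n \<Longrightarrow> (tent t ^^ n) 1 < 1 - \<eta>"
  shows "\<eta> / 6 \<le> kint t 1 (indicator {1 - \<eta>..1})"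
proof -
  have t1: "1 < t" using JJ_D[OF t] by simp
  let ?\<phi> = "indicator {1 - \<eta>..1} :: real \<Rightarrow> real"
  define a where "a n = ksign t 1 n / t ^ n * intv (- 1) ((tent t ^^ n) 1) ?\<phi>" for n
  \<comment> \<open>An upper bound for the size of \<open>a n\<close>; times that are multiples of
    \<open>m\<close> and also at least \<open>N\<close> are counted twice.\<close>
  define b where "b n = \<eta> * (if m dvd n then 1 / t ^ n else 0) + \<eta> * (if N \<le> n then 1 / t ^ n else 0)" for n
  note tail = indicator_Icc_tail[OF \<eta> funpow_in_II[OF t one_in_II]]
  have sa: "summable a" unfolding a_def
    by (rule kint_summable[OF t bdd_borel_indicator one_in_II]) simp
  have ab: "\<bar>a n\<bar> \<le> b n" for n
  proof (cases "m dvd n \<or> N \<le> n")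
    case True
    have "\<bar>a n\<bar> \<le> \<eta> * (1 / t ^ n)"
      using tail(1,2)[of n] t1 by (simp add: a_def abs_mult abs_ksign[OF t] divide_right_mono)
    also have "\<dots> \<le> b n" using True \<eta> t1 by (auto simp: b_def)
    finally show ?thesis .
  next
    case False
    then have "a n = 0" using tail(3)[of n] away[of n] by (simp add: a_def)
    then show ?thesis using \<eta> t1 by (simp add: b_def)
  qed
  have one: "1 < t ^ m" using m by simp
  have sb: "b sums (\<eta> * (1 / (1 - 1 / t ^ m)) + \<eta> * (1 / t ^ N * (t / (t - 1))))"
    unfolding b_def by (intro sums_add sums_mult sums_multiples sums_tail one m(1) t)
  have "1 / (1 - 1 / t ^ m) \<le> 5 / 3"
  proof -
    have "1 / t ^ m \<le> 2 / 5" using m(2) by (simp add: field_simps)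
    then have "3 / 5 \<le> 1 - 1 / t ^ m" by simp
    then have "1 / (1 - 1 / t ^ m) \<le> 1 / (3 / 5)" by (intro divide_left_mono) auto
    then show ?thesis by simp
  qed
  then have "1 / (1 - 1 / t ^ m) + 1 / t ^ N * (t / (t - 1)) \<le> 11 / 6" using N by linarith
  then have "\<eta> * (1 / (1 - 1 / t ^ m) + 1 / t ^ N * (t / (t - 1))) \<le> \<eta> * (11 / 6)"
    using \<eta> by (intro mult_left_mono) auto
  then have B: "suminf b \<le> \<eta> * (11 / 6)" using sums_unique[OF sb] unfolding distrib_left by (simp only:)
  have a0: "a 0 = \<eta>" using tail(4) by (simp add: a_def ksign_def)
  have sab: "summable (\<lambda>n. a n + b n)" using sa sb by (intro summable_add) (auto simp: sums_iff)
  \<comment> \<open>All terms \<open>a n + b n\<close> are nonnegative, so their sum is at least the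
    first one. Subtracting \<open>suminf b\<close> leaves the factor
    \<open>2 - 11 / 6 = 1 / 6\<close>.\<close>
  have "2 * \<eta> \<le> a 0 + b 0" using a0 ab[of 0] \<eta> by simp
  also have "\<dots> = (\<Sum>n\<in>{0}. a n + b n)" by simp
  also have "\<dots> \<le> (\<Sum>n. a n + b n)"
    using ab by (intro sum_le_suminf sab) (auto simp: abs_le_iff minus_le_iff add.commute real_0_le_add_iff)
  also have "\<dots> = suminf a + suminf b"
    using sa sb by (intro suminf_add[symmetric]) (auto simp: sums_iff)
  finally have "\<eta> / 6 \<le> suminf a" using B by simp
  then show ?thesis unfolding kint_def a_def .
qed

lemma birkhoff_integral_bound:
  assumes "bdd_borel M \<phi>"
  shows "\<bar>intv (- 1) 1 (birkhoff t N \<phi>) / 2\<bar> \<le> M"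
  using intv_m1_bound[OF bdd_borel_birkhoff[OF assms] one_in_II, of t N] by simp

lemma kint_tendsto:
  assumes "t \<in> JJ" "bdd_borel M \<phi>"
  shows "(\<lambda>N. kint t 1 (\<lambda>_. 1) * (intv (- 1) 1 (birkhoff t N \<phi>) / 2)) \<longlonglongrightarrow> kint t 1 \<phi>"
proof (rule LIM_zero_cancel, rule Lim_null_comparison)
  show "\<forall>\<^sub>F N in sequentially. norm (kint t 1 (\<lambda>_. 1) * (intv (- 1) 1 (birkhoff t N \<phi>) / 2) - kint t 1 \<phi>)
     \<le> 8 * M * (t / (t - 1))\<^sup>2 / real N"
    using eventually_gt_at_top[of 0]
    by eventually_elim (use kint_1_mix[OF assms] in \<open>simp add: abs_minus_commute\<close>)
  show "(\<lambda>N. 8 * M * (t / (t - 1))\<^sup>2 / real N) \<longlonglongrightarrow> 0"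
    by (rule lim_const_over_n)
qed

text \<open>By \<open>kint_tendsto\<close> the functional is the total mass times a limit of
  averages bounded by \<open>M\<close>. A lower bound on a single indicator thus forces one on the
  mass.\<close>

lemma kint_le_mass:
  assumes "t \<in> JJ" "bdd_borel M \<phi>" shows "\<bar>kint t 1 \<phi>\<bar> \<le> \<bar>kint t 1 (\<lambda>_. 1)\<bar> * M"
proof (rule LIMSEQ_le_const2)
  show "(\<lambda>N. \<bar>kint t 1 (\<lambda>_. 1) * (intv (- 1) 1 (birkhoff t N \<phi>) / 2)\<bar>) \<longlonglongrightarrow> \<bar>kint t 1 \<phi>\<bar>"
    by (intro tendsto_rabs kint_tendsto[OF assms])
  show "\<exists>N. \<forall>n\<ge>N. \<bar>kint t 1 (\<lambda>_. 1) * (intv (- 1) 1 (birkhoff t n \<phi>) / 2)\<bar> \<le> \<bar>kint t 1 (\<lambda>_. 1)\<bar> * M"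
    unfolding abs_mult using birkhoff_integral_bound[OF assms(2)] by (intro exI allI impI mult_left_mono) auto
qed

text \<open>Under \<open>t0\<close> the orbit of 1 can return to 1 only at multiples of
  \<open>m\<close>; at the other times before a fixed \<open>N\<close> it keeps a positive distance.
  By continuity in the slope this persists near \<open>t0\<close>, with
  \<open>3 \<le> t0 ^ m\<close> relaxed to \<open>5 / 2\<close>, so
  \<open>kint_indicator_lower\<close> applies with one window for all nearby slopes.\<close>

lemma kint_mass_lower:
  assumes t0: "t0 \<in> JJ"
  obtains c where "0 < c" "\<forall>\<^sub>F t in nhds t0. t \<in> JJ \<longrightarrow> c \<le> \<bar>kint t 1 (\<lambda>_. 1)\<bar>"
proof -
  obtain m where m: "0 < m" "3 \<le> t0 ^ m" "\<And>n. (tent t0 ^^ n) 1 = 1 \<Longrightarrow> m dvd n"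
    using exists_expanding_return[OF t0] by blast
  obtain r where r: "1 < r" "\<forall>\<^sub>F t in nhds t0. r < t" using JJ_neighbourhood[OF t0] .
  \<comment> \<open>This dominates the tail \<open>1 / t ^ N * (t / (t - 1))\<close> for all
    \<open>t\<close> in \<open>JJ\<close> above \<open>r\<close>, so that \<open>N\<close> is chosen
    before \<open>t\<close>.\<close>
  have "(\<lambda>N. inverse (r ^ N) * (2 / (r - 1))) \<longlonglongrightarrow> 0"
    using LIMSEQ_inverse_realpow_zero[OF r(1)] by (rule tendsto_mult_left_zero)
  then have "\<forall>\<^sub>F N in sequentially. inverse (r ^ N) * (2 / (r - 1)) < 1 / 6"
    by (rule order_tendstoD) simp
  then obtain N where N: "inverse (r ^ N) * (2 / (r - 1)) < 1 / 6"
    by (auto simp: eventually_sequentially)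
  have orb: "((\<lambda>t. (tent t ^^ n) 1) \<longlongrightarrow> (tent t0 ^^ n) 1) (nhds t0)" for n
    by (intro tendsto_funpow_tent tendsto_intros filterlim_ident)
  define S where "S = {n. n < N \<and> \<not> m dvd n}"
  have finS: "finite S" by (simp add: S_def)
  \<comment> \<open>Half the smallest distance to 1 makes the inequalities strict and hence stable
    in \<open>t\<close>. The entry 2 keeps the set nonempty and the window inside
    \<open>II\<close>.\<close>
  define \<eta> where "\<eta> = Min (insert 2 ((\<lambda>n. (1 - (tent t0 ^^ n) 1) / 2) ` S))"
  have lt: "(tent t0 ^^ n) 1 < 1" if "n \<in> S" for n
    using that m(3)[of n] funpow_in_II[OF t0 one_in_II, of n] by (auto simp: S_def II_def less_le)
  have \<eta>: "0 < \<eta>" "\<eta> \<le> 2" using finS lt by (auto simp: \<eta>_def)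
  have \<eta>S: "(tent t0 ^^ n) 1 < 1 - \<eta>" if "n \<in> S" for n
  proof -
    have "\<eta> \<le> (1 - (tent t0 ^^ n) 1) / 2" unfolding \<eta>_def using finS that by (intro Min_le) auto
    then show ?thesis using lt[OF that] by (simp add: field_simps)
  qed
  have ev1: "\<forall>\<^sub>F t in nhds t0. \<forall>n\<in>S. (tent t ^^ n) 1 < 1 - \<eta>"
    using finS \<eta>S orb by (intro eventually_ball_finite) (auto dest: order_tendstoD(2))
  have ev2: "\<forall>\<^sub>F t in nhds t0. 5 / 2 < t ^ m"
    by (rule order_tendstoD(1)[of _ "t0 ^ m"]) (use m in \<open>auto intro!: tendsto_intros filterlim_ident\<close>)
  have "\<forall>\<^sub>F t in nhds t0. t \<in> JJ \<longrightarrow> \<eta> / 6 \<le> \<bar>kint t 1 (\<lambda>_. 1)\<bar>"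
    using ev1 ev2 r(2)
  proof (eventually_elim, intro impI)
    fix t assume A: "\<forall>n\<in>S. (tent t ^^ n) 1 < 1 - \<eta>" "5 / 2 < t ^ m" "r < t" and t: "t \<in> JJ"
    have "1 / t ^ N * (t / (t - 1)) \<le> inverse (r ^ N) * (2 / (r - 1))"
      using A(3) r(1) JJ_D[OF t]
      by (intro mult_mono frac_le) (auto simp: divide_inverse intro!: power_mono le_imp_inverse_le)
    then have "1 / t ^ N * (t / (t - 1)) \<le> 1 / 6" using N by (rule order.trans[OF _ less_imp_le])
    then have "\<eta> / 6 \<le> kint t 1 (indicator {1 - \<eta>..1})"
      using A(1) by (intro kint_indicator_lower[OF t \<eta> m(1) less_imp_le[OF A(2)]]) (auto simp: S_def)
    moreover have "\<bar>kint t 1 (indicator {1 - \<eta>..1})\<bar> \<le> \<bar>kint t 1 (\<lambda>_. 1)\<bar> * 1"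
      by (intro kint_le_mass t bdd_borel_indicator) simp
    ultimately show "\<eta> / 6 \<le> \<bar>kint t 1 (\<lambda>_. 1)\<bar>" by linarith
  qed
  then show ?thesis using that[of "\<eta> / 6"] \<eta> by simp
qed

lemma kint_mass_nonzero: "t \<in> JJ \<Longrightarrow> kint t 1 (\<lambda>_. 1) \<noteq> 0"
proof -
  assume t: "t \<in> JJ"
  obtain c where "0 < c" "\<forall>\<^sub>F s in nhds t. s \<in> JJ \<longrightarrow> c \<le> \<bar>kint s 1 (\<lambda>_. 1)\<bar>"
    using kint_mass_lower[OF t] .
  then show ?thesis using t eventually_nhds_x_imp_x by fastforce
qed

section \<open>The absolutely continuous invariant measure\<close>

text \<open>This is \<open>kint t 1\<close> with sum and integral exchanged: up to normalisation,
  the invariant density. The terms have both signs; nonnegativity is obtained only after division by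
  the total mass, in \<open>kdens_nonneg_AE\<close>.\<close>

definition kdens :: "real \<Rightarrow> real \<Rightarrow> real" where
  "kdens t x = (\<Sum>n. ksign t 1 n / t ^ n * indicator {- 1..(tent t ^^ n) 1} x)"

lemma kdens_measurable [measurable]: "kdens t \<in> borel_measurable borel"
  unfolding kdens_def[abs_def] by measurable

lemma kdens_outside: "t \<in> JJ \<Longrightarrow> x \<notin> II \<Longrightarrow> kdens t x = 0"
proof -
  assume "t \<in> JJ" "x \<notin> II"
  then have "x \<notin> {- 1..(tent t ^^ n) 1}" for n
    using funpow_in_II[of t 1 n] by (auto simp: II_def)
  then show ?thesis by (simp add: kdens_def)
qed

lemma kdens_bound:
  assumes "t \<in> JJ" shows "\<bar>kdens t x\<bar> \<le> t / (t - 1)"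
  unfolding kdens_def using kneading_series(2)[OF assms, of _ 1] by (auto simp: indicator_def)

lemma kint_eq_integral_kdens:
  assumes t: "t \<in> JJ" and \<phi>: "bdd_borel M \<phi>"
  shows "kint t 1 \<phi> = (\<integral>x. kdens t x * \<phi> x \<partial>lborel)"
proof -
  let ?f = "\<lambda>n x. ksign t 1 n / t ^ n * (indicator {- 1..(tent t ^^ n) 1} x * \<phi> x)"
  have abs_f: "norm (?f n x) = 1 / t ^ n * (indicator {- 1..(tent t ^^ n) 1} x * \<bar>\<phi> x\<bar>)" for n x
    using JJ_D[OF t] by (simp add: abs_mult abs_ksign[OF t])
  have "(\<integral>x. (\<Sum>n. ?f n x) \<partial>lborel) = (\<Sum>n. \<integral>x. ?f n x \<partial>lborel)"
  proof (rule integral_suminf)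
    show "integrable lborel (?f n)" for n
      by (intro integrable_mult_right intv_integrable[OF \<phi>])
    have "summable (\<lambda>n. 1 / t ^ n * (indicator {- 1..(tent t ^^ n) 1} x * \<bar>\<phi> x\<bar>))" for x
    proof (rule summable_comparison_test')
      show "summable (\<lambda>n. M / t ^ n)" using inverse_powers_sums[OF t] by (rule sums_summable)
      show "norm (1 / t ^ n * (indicator {- 1..(tent t ^^ n) 1} x * \<bar>\<phi> x\<bar>)) \<le> M / t ^ n" for n
        using JJ_D[OF t] bdd_borelD(2)[OF \<phi>, of x] bdd_borel_nonneg[OF \<phi>]
        by (auto simp: indicator_def divide_right_mono)
    qed
    then show "AE x in lborel. summable (\<lambda>n. norm (?f n x))" unfolding abs_f by simp
    have abs_\<phi>: "bdd_borel M (\<lambda>x. \<bar>\<phi> x\<bar>)" using \<phi> by (auto simp: bdd_borel_def)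
    have int: "(\<integral>x. norm (?f n x) \<partial>lborel) = 1 / t ^ n * intv (- 1) ((tent t ^^ n) 1) (\<lambda>x. \<bar>\<phi> x\<bar>)" for n
      unfolding abs_f intv_def by simp
    show "summable (\<lambda>n. \<integral>x. norm (?f n x) \<partial>lborel)"
    proof (rule summable_comparison_test')
      show "summable (\<lambda>n. (2 * M) / t ^ n)" using inverse_powers_sums[OF t] by (rule sums_summable)
      show "norm (\<integral>x. norm (?f n x) \<partial>lborel) \<le> (2 * M) / t ^ n" for n
        unfolding int using JJ_D[OF t] intv_orbit_bound[OF t abs_\<phi> one_in_II, of n]
        by (simp add: abs_mult divide_right_mono)
    qed
  qed
  moreover have "(\<Sum>n. ?f n x) = kdens t x * \<phi> x" for x
  proof -
    have "summable (\<lambda>n. ksign t 1 n / t ^ n * indicator {- 1..(tent t ^^ n) 1} x)"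
      by (rule kneading_series(1)[OF t, of _ 1]) (auto simp: indicator_def)
    from suminf_mult2[OF this, of "\<phi> x"] show ?thesis by (simp add: kdens_def mult.assoc)
  qed
  moreover have "(\<integral>x. ?f n x \<partial>lborel) = ksign t 1 n / t ^ n * intv (- 1) ((tent t ^^ n) 1) \<phi>" for n
    unfolding intv_def by simp
  ultimately show ?thesis by (simp only: kint_def)
qed

lemma kdens_integrable:
  assumes t: "t \<in> JJ" and \<phi>: "bdd_borel M \<phi>"
  shows "integrable lborel (\<lambda>x. kdens t x * \<phi> x)"
proof (rule Bochner_Integration.integrable_bound)
  show "integrable lborel (\<lambda>x. (t / (t - 1) * M) * indicator {- 1..1::real} x)"
    by (rule integrable_indicator_Icc)
  show "(\<lambda>x. kdens t x * \<phi> x) \<in> borel_measurable lborel" using bdd_borelD(1)[OF \<phi>] by simp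
  have "\<bar>kdens t x * \<phi> x\<bar> \<le> (t / (t - 1) * M) * indicator {- 1..1} x" for x
  proof (cases "x \<in> II")
    case True
    then show ?thesis
      using mult_mono[OF kdens_bound[OF t, of x] bdd_borelD(2)[OF \<phi>, of x]] JJ_D[OF t]
      by (auto simp: II_def abs_mult)
  next
    case False
    then show ?thesis using kdens_outside[OF t False] bdd_borel_nonneg[OF \<phi>] JJ_D[OF t] by (simp add: indicator_def)
  qed
  then show "AE x in lborel. norm (kdens t x * \<phi> x) \<le> norm ((t / (t - 1) * M) * indicator {- 1..1} x)"
    unfolding real_norm_def by (intro AE_I2 order.trans[OF _ abs_ge_self])
qed

definition acim_mean :: "real \<Rightarrow> (real \<Rightarrow> real) \<Rightarrow> real" where
  "acim_mean t \<phi> = kint t 1 \<phi> / kint t 1 (\<lambda>_. 1)"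

lemma acim_mean_tendsto:
  assumes "t \<in> JJ" "bdd_borel M \<phi>"
  shows "(\<lambda>N. intv (- 1) 1 (birkhoff t N \<phi>) / 2) \<longlonglongrightarrow> acim_mean t \<phi>"
  using tendsto_divide[OF kint_tendsto[OF assms] tendsto_const kint_mass_nonzero[OF assms(1)]]
    kint_mass_nonzero[OF assms(1)] by (simp add: acim_mean_def)

text \<open>Positivity, hidden in the signed series, is inherited from the Lebesgue means of
  Birkhoff averages that approximate it.\<close>

lemma acim_mean_nonneg:
  assumes "t \<in> JJ" "bdd_borel M \<phi>" "\<And>x. 0 \<le> \<phi> x" shows "0 \<le> acim_mean t \<phi>"
proof (rule LIMSEQ_le_const[OF acim_mean_tendsto[OF assms(1,2)]])
  have "0 \<le> intv (- 1) 1 (birkhoff t n \<phi>)" for n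
    unfolding intv_def birkhoff_def
    using assms(3) by (intro Bochner_Integration.integral_nonneg) (intro mult_nonneg_nonneg divide_nonneg_nonneg sum_nonneg, auto)
  then show "\<exists>N. \<forall>n\<ge>N. 0 \<le> intv (- 1) 1 (birkhoff t n \<phi>) / 2" by simp
qed

text \<open>On the indicator of the set where the normalised density is negative, the mean is
  nonnegative by \<open>acim_mean_nonneg\<close>; the integral of the density over that set is
  therefore 0.\<close>

lemma kdens_nonneg_AE:
  assumes t: "t \<in> JJ" shows "AE x in lborel. 0 \<le> kdens t x / kint t 1 (\<lambda>_. 1)"
proof -
  let ?\<rho> = "\<lambda>x. kdens t x / kint t 1 (\<lambda>_. 1)"
  define B where "B = {x. ?\<rho> x < 0}"
  have B: "B \<in> sets borel" unfolding B_def by measurable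
  note bB = bdd_borel_indicator[OF B]
  have int: "integrable lborel (\<lambda>x. - ?\<rho> x * indicator B x)"
    using integrable_mult_right[OF kdens_integrable[OF t bB], of "- 1 / kint t 1 (\<lambda>_. 1)"] by simp
  have nn: "0 \<le> - ?\<rho> x * indicator B x" for x by (auto simp: B_def indicator_def)
  have "(\<integral>x. - ?\<rho> x * indicator B x \<partial>lborel) = - acim_mean t (indicator B)"
    using kint_eq_integral_kdens[OF t bB] by (simp add: acim_mean_def)
  also have "\<dots> \<le> 0" using acim_mean_nonneg[OF t bB] by simp
  finally have "(\<integral>x. - ?\<rho> x * indicator B x \<partial>lborel) = 0"
    using Bochner_Integration.integral_nonneg[of lborel "\<lambda>x. - ?\<rho> x * indicator B x"] nn by fastforce
  then have "AE x in lborel. - ?\<rho> x * indicator B x = 0"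
    using integral_nonneg_eq_0_iff_AE[OF int] nn by simp
  then show ?thesis by eventually_elim (auto simp: B_def indicator_def split: if_splits)
qed

lemma II_sets [measurable]: "II \<in> sets borel" by (simp add: II_def)

lemma tent_measurable_II:
  "t \<in> JJ \<Longrightarrow> tent t \<in> measurable (restrict_space borel II) (restrict_space borel II)"
  by (rule measurable_restrict_space3) (auto simp: tent_in_II)

definition tent_acim :: "real \<Rightarrow> real measure" where
  "tent_acim t = density (restrict_space lborel II) (\<lambda>x. ennreal (kdens t x / kint t 1 (\<lambda>_. 1)))"

lemma integral_tent_acim:
  assumes t: "t \<in> JJ" and \<phi>: "bdd_borel M \<phi>"
  shows "(\<integral>x. \<phi> x \<partial>tent_acim t) = acim_mean t \<phi>"
proof -
  have [measurable]: "\<phi> \<in> borel_measurable borel" using bdd_borelD[OF \<phi>] by simp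
  have "(\<integral>x. \<phi> x \<partial>tent_acim t) = (\<integral>x. kdens t x / kint t 1 (\<lambda>_. 1) * \<phi> x \<partial>restrict_space lborel II)"
    unfolding tent_acim_def
  proof (subst integral_density)
    show "AE x in restrict_space lborel II. 0 \<le> kdens t x / kint t 1 (\<lambda>_. 1)"
      using kdens_nonneg_AE[OF t] by (subst AE_restrict_space_iff) auto
  qed (auto intro!: measurable_restrict_space1)
  also have "\<dots> = (\<integral>x. kdens t x / kint t 1 (\<lambda>_. 1) * \<phi> x \<partial>lborel)"
    using kdens_outside[OF t] by (subst integral_restrict_space) (auto intro!: Bochner_Integration.integral_cong simp: indicator_def)
  also have "\<dots> = acim_mean t \<phi>"
    by (simp add: acim_mean_def kint_eq_integral_kdens[OF t \<phi>])
  finally show ?thesis .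
qed

lemma sets_tent_acim: "sets (tent_acim t) = sets (restrict_space borel II)"
  unfolding tent_acim_def sets_density by (rule sets_restrict_space_cong) simp

lemma space_tent_acim: "space (tent_acim t) = II"
  using sets_eq_imp_space_eq[OF sets_tent_acim] by (simp add: space_restrict_space)

lemma is_acim_tent_acim:
  assumes t: "t \<in> JJ" shows "is_acim t (tent_acim t)"
proof -
  have one: "bdd_borel 1 (\<lambda>_. 1)" by (simp add: bdd_borel_def)
  have m1: "acim_mean t (\<lambda>_. 1) = 1" using kint_mass_nonzero[OF t] by (simp add: acim_mean_def)
  have int: "integrable lborel (\<lambda>x. kdens t x / kint t 1 (\<lambda>_. 1))"
    using kdens_integrable[OF t one] by simp
  have "emeasure (tent_acim t) II = (\<integral>\<^sup>+x\<in>II. ennreal (kdens t x / kint t 1 (\<lambda>_. 1)) \<partial>lborel)"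
    unfolding tent_acim_def
    by (subst emeasure_density)
       (auto intro!: measurable_restrict_space1 simp: sets_restrict_space nn_integral_restrict_space mult.assoc
         intro!: nn_integral_cong simp: indicator_def)
  also have "\<dots> = (\<integral>\<^sup>+x. ennreal (kdens t x / kint t 1 (\<lambda>_. 1)) \<partial>lborel)"
    using kdens_outside[OF t] by (intro nn_integral_cong) (auto simp: indicator_def)
  also have "\<dots> = ennreal (\<integral>x. kdens t x / kint t 1 (\<lambda>_. 1) \<partial>lborel)"
    by (rule nn_integral_eq_integral[OF int kdens_nonneg_AE[OF t]])
  also have "(\<integral>x. kdens t x / kint t 1 (\<lambda>_. 1) \<partial>lborel) = 1"
    using m1 kint_eq_integral_kdens[OF t one] by (simp add: acim_mean_def)
  finally have P: "prob_space (tent_acim t)"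
    by (intro prob_spaceI) (simp add: space_tent_acim)
  interpret prob_space "tent_acim t" by (rule P)
  have ac: "absolutely_continuous (restrict_space lborel II) (tent_acim t)"
    unfolding tent_acim_def
    by (intro absolutely_continuousI_density) (auto intro!: measurable_restrict_space1)
  have meas: "tent t \<in> measurable (tent_acim t) (restrict_space borel II)"
    using tent_measurable_II[OF t] by (simp cong: measurable_cong_sets add: sets_tent_acim)
  have "distr (tent_acim t) (restrict_space borel II) (tent t) = tent_acim t"
  proof (rule measure_eqI)
    show "sets (distr (tent_acim t) (restrict_space borel II) (tent t)) = sets (tent_acim t)"
      by (simp add: sets_tent_acim)
    fix A assume "A \<in> sets (distr (tent_acim t) (restrict_space borel II) (tent t))"
    then have A: "A \<in> sets (restrict_space borel II)" by simp
    then have A': "A \<in> sets borel" "A \<subseteq> II"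
      by (auto simp: sets_restrict_space_iff)
    note bA = bdd_borel_indicator[OF A'(1)]
    have pre: "tent t -` A \<inter> II \<in> sets (tent_acim t)"
      using measurable_sets[OF meas A] by (simp add: space_tent_acim)
    \<comment> \<open>Invariance is checked on indicators, where it reduces to
      \<open>kint_1_invariant\<close>.\<close>
    have "measure (tent_acim t) (tent t -` A \<inter> II) = (\<integral>x. indicator (tent t -` A \<inter> II) x \<partial>tent_acim t)"
      using sets.sets_into_space[OF pre] by (simp add: space_tent_acim Int_absorb2)
    also have "\<dots> = (\<integral>x. indicator A (tent t x) \<partial>tent_acim t)"
      by (intro Bochner_Integration.integral_cong) (auto simp: space_tent_acim indicator_def)
    also have "\<dots> = acim_mean t (\<lambda>x. indicator A (tent t x))"
      by (rule integral_tent_acim[OF t bdd_borel_comp[OF bA tent_measurable]])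
    also have "\<dots> = acim_mean t (indicator A)"
      by (simp add: acim_mean_def kint_1_invariant[OF t bA])
    also have "\<dots> = (\<integral>x. indicator A x \<partial>tent_acim t)" by (rule integral_tent_acim[OF t bA, symmetric])
    also have "\<dots> = measure (tent_acim t) A"
      using A' by (simp add: space_tent_acim Int_absorb2)
    finally show "emeasure (distr (tent_acim t) (restrict_space borel II) (tent t)) A = emeasure (tent_acim t) A"
      by (simp add: emeasure_distr[OF meas A] space_tent_acim emeasure_eq_measure)
  qed
  then show ?thesis unfolding is_acim_def using P ac sets_tent_acim by blast
qed

section \<open>Equidistribution against integrable densities, and uniqueness of the invariant
  measure\<close>

lemma indicator_II_integrable:
  assumes "bdd_borel K \<psi>" "A \<in> sets borel"
  shows "integrable lborel (\<lambda>x. indicator A x * (indicator II x * \<psi> x))"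
proof -
  have "integrable lborel (\<lambda>x. indicator II x * \<psi> x)"
    unfolding II_def by (rule intv_integrable[OF assms(1)])
  from integrable_mult_indicator[OF _ this, of A] show ?thesis using assms(2) by simp
qed

lemma indicator_II_bound:
  assumes \<psi>: "bdd_borel K \<psi>" and A: "A \<in> sets borel"
  shows "\<bar>\<integral>x. indicator A x * (indicator II x * \<psi> x) \<partial>lborel\<bar> \<le> K * measure lborel (A \<inter> II)"
proof -
  have fin: "emeasure lborel (A \<inter> II) < \<infinity>"
    using emeasure_mono[of "A \<inter> II" II lborel] by (auto simp: II_def less_top[symmetric] top_unique)
  have "\<bar>\<integral>x. indicator A x * (indicator II x * \<psi> x) \<partial>lborel\<bar> \<le> (\<integral>x. \<bar>indicator A x * (indicator II x * \<psi> x)\<bar> \<partial>lborel)"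
    by (rule integral_abs_bound)
  also have "\<dots> \<le> (\<integral>x. K * indicator (A \<inter> II) x \<partial>lborel)"
  proof (rule integral_mono)
    show "integrable lborel (\<lambda>x. \<bar>indicator A x * (indicator II x * \<psi> x)\<bar>)"
      by (rule integrable_abs[OF indicator_II_integrable[OF assms]])
    show "integrable lborel (\<lambda>x. K * indicator (A \<inter> II) x)"
      using A fin by (intro integrable_mult_right integrable_real_indicator) auto
  qed (use bdd_borelD[OF \<psi>] in \<open>auto simp: indicator_def\<close>)
  also have "\<dots> = K * measure lborel (A \<inter> II)" by simp
  finally show ?thesis .
qed

lemma indicator_II_disjoint_UN:
  fixes f :: "nat \<Rightarrow> real set"
  assumes f: "disjoint_family f" "\<And>i. f i \<in> sets borel" and \<psi>: "bdd_borel K \<psi>"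
  shows "(\<integral>x. indicator (\<Union>i. f i) x * (indicator II x * \<psi> x) \<partial>lborel)
    = (\<Sum>i. \<integral>x. indicator (f i) x * (indicator II x * \<psi> x) \<partial>lborel)"
proof -
  have U: "(\<Union>i. f i) \<in> sets borel" using f(2) by blast
  have "(LINT x:(\<Union>i. f i)|lborel. indicator II x * \<psi> x) = (\<Sum>i. LINT x:f i|lborel. indicator II x * \<psi> x)"
  proof (rule lebesgue_integral_countable_add)
    show "f i \<inter> f j = {}" if "i \<noteq> j" for i j using f(1) that by (auto simp: disjoint_family_on_def)
    show "set_integrable lborel (\<Union>i. f i) (\<lambda>x. indicator II x * \<psi> x)"
      using indicator_II_integrable[OF \<psi> U] by (simp add: set_integrable_def)
  qed (use f in auto)
  then show ?thesis by (simp add: set_lebesgue_integral_def)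
qed

text \<open>Closed intervals are differences of initial ones, and complements are subtracted from
  the total. For disjoint unions, sum and limit are exchanged by Tannery's theorem, the terms being
  dominated by \<open>K\<close> times the measures of disjoint subsets of \<open>II\<close>.\<close>

lemma equidistributed_on_borel:
  assumes \<psi>: "\<And>N. bdd_borel K (\<psi> N)"
    and lim: "\<And>z. z \<in> II \<Longrightarrow> (\<lambda>N. intv (- 1) z (\<psi> N)) \<longlonglongrightarrow> 0"
    and A: "A \<in> sets borel"
  shows "(\<lambda>N. \<integral>x. indicator A x * (indicator II x * \<psi> N x) \<partial>lborel) \<longlonglongrightarrow> 0"
  using A
proof (induction rule: borel_set_induct)
  case empty
  then show ?case by simp
next
  case (interval a b)
  define a' where "a' = max (- 1) a"
  define b' where "b' = min 1 b"
  have prod: "indicator {a..b} x * (indicator II x * y) = indicator {a'..b'} x * y" for x y :: real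
    by (auto simp: indicator_def II_def a'_def b'_def)
  show ?case
  proof (cases "a' \<le> b'")
    case True
    then have *: "a' \<in> II" "b' \<in> II" "- 1 \<le> a'" by (auto simp: II_def a'_def b'_def)
    have "intv a' b' (\<psi> N) = intv (- 1) b' (\<psi> N) - intv (- 1) a' (\<psi> N)" for N
      using intv_split[OF \<psi>, of "- 1" a' b'] True * by simp
    then show ?thesis unfolding prod using tendsto_diff[OF lim[OF *(2)] lim[OF *(1)]]
      by (simp add: intv_def)
  next
    case False
    then show ?thesis unfolding prod by simp
  qed
next
  case (compl A)
  have "(\<integral>x. indicator (- A) x * (indicator II x * \<psi> N x) \<partial>lborel)
      = intv (- 1) 1 (\<psi> N) - (\<integral>x. indicator A x * (indicator II x * \<psi> N x) \<partial>lborel)" for N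
  proof -
    have "(\<integral>x. indicator (- A) x * (indicator II x * \<psi> N x) \<partial>lborel)
       = (\<integral>x. indicator UNIV x * (indicator II x * \<psi> N x) - indicator A x * (indicator II x * \<psi> N x) \<partial>lborel)"
      by (intro Bochner_Integration.integral_cong) (auto simp: indicator_def)
    also have "\<dots> = (\<integral>x. indicator UNIV x * (indicator II x * \<psi> N x) \<partial>lborel) - (\<integral>x. indicator A x * (indicator II x * \<psi> N x) \<partial>lborel)"
      by (intro Bochner_Integration.integral_diff indicator_II_integrable[OF \<psi>] compl) simp
    finally show ?thesis by (simp add: intv_def II_def)
  qed
  then show ?case using tendsto_diff[OF lim[OF one_in_II] compl(2)] by simp
next
  case (union f)
  let ?a = "\<lambda>k N. \<integral>x. indicator (f k) x * (indicator II x * \<psi> N x) \<partial>lborel"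
  have fin: "emeasure lborel (\<Union>i. f i \<inter> II) \<noteq> \<infinity>"
    using emeasure_mono[of "\<Union>i. f i \<inter> II" II lborel] by (auto simp: II_def top_unique)
  have "(\<lambda>i. measure lborel (f i \<inter> II)) sums measure lborel (\<Union>i. f i \<inter> II)"
    using union(1,2) by (intro measure_UNION fin) (auto simp: disjoint_family_on_def)
  then have sm: "summable (\<lambda>k. K * measure lborel (f k \<inter> II))"
    by (intro summable_mult) (rule sums_summable)
  have "((\<lambda>N. suminf (\<lambda>k. ?a k N)) \<longlongrightarrow> suminf (\<lambda>_::nat. 0)) sequentially"
  proof (rule conjunct2[OF conjunct2[OF tannerys_theorem[OF union(3) _ sm]]])
    show "\<forall>\<^sub>F (k, N) in at_top \<times>\<^sub>F sequentially. norm (?a k N) \<le> K * measure lborel (f k \<inter> II)"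
      using indicator_II_bound[OF \<psi> union(2)] by (intro always_eventually) auto
  qed simp
  then show ?case using indicator_II_disjoint_UN[OF union(1,2) \<psi>] by simp
qed

text \<open>Approximation by simple functions in the integral norm: thanks to the uniform bound
  \<open>K\<close>, the error is at most \<open>K\<close> times the distance, for all
  \<open>N\<close> at once.\<close>

lemma equidistributed_integrable:
  assumes \<psi>: "\<And>N. bdd_borel K (\<psi> N)"
    and lim: "\<And>z. z \<in> II \<Longrightarrow> (\<lambda>N. intv (- 1) z (\<psi> N)) \<longlonglongrightarrow> 0"
    and g: "integrable lborel g"
  shows "(\<lambda>N. \<integral>x. g x * (indicator II x * \<psi> N x) \<partial>lborel) \<longlonglongrightarrow> 0"
proof -
  have int: "integrable lborel (\<lambda>x. u x * (indicator II x * \<psi> N x))"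
    "\<bar>\<integral>x. u x * (indicator II x * \<psi> N x) \<partial>lborel\<bar> \<le> K * (\<integral>x. \<bar>u x\<bar> \<partial>lborel)"
    if u: "integrable lborel u" for u N
  proof -
    have le: "\<bar>u x * (indicator II x * \<psi> N x)\<bar> \<le> K * \<bar>u x\<bar>" for x
      using mult_right_mono[OF bdd_borelD(2)[OF \<psi>, of N x] abs_ge_zero[of "u x"]] bdd_borel_nonneg[OF \<psi>]
      by (auto simp: indicator_def abs_mult mult.commute)
    show i: "integrable lborel (\<lambda>x. u x * (indicator II x * \<psi> N x))"
    proof (rule Bochner_Integration.integrable_bound)
      show "integrable lborel (\<lambda>x. K * \<bar>u x\<bar>)" using u by simp
      show "AE x in lborel. norm (u x * (indicator II x * \<psi> N x)) \<le> norm (K * \<bar>u x\<bar>)"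
        unfolding real_norm_def using le by (intro AE_I2 order.trans[OF _ abs_ge_self])
      show "(\<lambda>x. u x * (indicator II x * \<psi> N x)) \<in> borel_measurable lborel"
        using bdd_borelD(1)[OF \<psi>] borel_measurable_integrable[OF u] by simp
    qed
    have "\<bar>\<integral>x. u x * (indicator II x * \<psi> N x) \<partial>lborel\<bar> \<le> (\<integral>x. \<bar>u x * (indicator II x * \<psi> N x)\<bar> \<partial>lborel)"
      by (rule integral_abs_bound)
    also have "\<dots> \<le> (\<integral>x. K * \<bar>u x\<bar> \<partial>lborel)"
      using i u le by (intro integral_mono) auto
    finally show "\<bar>\<integral>x. u x * (indicator II x * \<psi> N x) \<partial>lborel\<bar> \<le> K * (\<integral>x. \<bar>u x\<bar> \<partial>lborel)" by simp
  qed
  show ?thesis using g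
  proof induction
    case (base A c)
    have "A \<in> sets borel" using base by simp
    from tendsto_mult_left[OF equidistributed_on_borel[OF \<psi> lim this], of c]
    show ?case by (simp add: mult.assoc mult.left_commute)
  next
    case (add u v)
    have "(\<integral>x. (u x + v x) * (indicator II x * \<psi> N x) \<partial>lborel)
        = (\<integral>x. u x * (indicator II x * \<psi> N x) \<partial>lborel) + (\<integral>x. v x * (indicator II x * \<psi> N x) \<partial>lborel)" for N
      unfolding distrib_right by (intro Bochner_Integration.integral_add int(1) add(1,2))
    then show ?case using tendsto_add[OF add.IH] by simp
  next
    case (lim u s)
    have "(\<lambda>i. \<integral>x. \<bar>u x - s i x\<bar> \<partial>lborel) \<longlonglongrightarrow> (\<integral>x. 0 \<partial>(lborel :: real measure))"
    proof (rule integral_dominated_convergence)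
      \<comment> \<open>The approximating functions are bounded by \<open>2 * norm (u x)\<close>,
        whence the factor 3.\<close>
      show "integrable lborel (\<lambda>x. 3 * norm (u x))" using lim by simp
      show "AE x in lborel. (\<lambda>i. \<bar>u x - s i x\<bar>) \<longlonglongrightarrow> 0"
      proof (rule AE_I2)
        fix x :: real
        have "(\<lambda>i. s i x) \<longlonglongrightarrow> u x" using lim(2)[of x] by simp
        from tendsto_rabs[OF tendsto_diff[OF tendsto_const this, of "u x"]]
        show "(\<lambda>i. \<bar>u x - s i x\<bar>) \<longlonglongrightarrow> 0" by simp
      qed
      show "AE x in lborel. norm \<bar>u x - s i x\<bar> \<le> 3 * norm (u x)" for i
      proof (rule AE_I2)
        fix x :: real show "norm \<bar>u x - s i x\<bar> \<le> 3 * norm (u x)"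
          using lim(3)[of x i] abs_triangle_ineq4[of "u x" "s i x"] by simp
      qed
    qed (use lim(1,4) in \<open>auto dest!: borel_measurable_integrable\<close>)
    then have app: "(\<lambda>i. K * (\<integral>x. \<bar>u x - s i x\<bar> \<partial>lborel)) \<longlonglongrightarrow> 0"
      using tendsto_mult_left by fastforce
    show ?case
    proof (rule LIMSEQ_I)
      fix e :: real assume "0 < e"
      then have "\<forall>\<^sub>F i in sequentially. K * (\<integral>x. \<bar>u x - s i x\<bar> \<partial>lborel) < e / 2"
        using app by (intro order_tendstoD) auto
      then obtain i where i: "K * (\<integral>x. \<bar>u x - s i x\<bar> \<partial>lborel) < e / 2" by (auto simp: eventually_sequentially)
      obtain N0 where N0: "\<And>N. N0 \<le> N \<Longrightarrow> norm ((\<integral>x. s i x * (indicator II x * \<psi> N x) \<partial>lborel) - 0) < e / 2"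
        using LIMSEQ_D[OF lim(5)[of i], of "e / 2"] \<open>0 < e\<close> by auto
      have "norm ((\<integral>x. u x * (indicator II x * \<psi> N x) \<partial>lborel) - 0) < e" if "N0 \<le> N" for N
      proof -
        have "(\<integral>x. (u x - s i x) * (indicator II x * \<psi> N x) \<partial>lborel)
          = (\<integral>x. u x * (indicator II x * \<psi> N x) \<partial>lborel) - (\<integral>x. s i x * (indicator II x * \<psi> N x) \<partial>lborel)"
          unfolding left_diff_distrib by (intro Bochner_Integration.integral_diff int(1) lim(1,4))
        moreover have "\<bar>\<integral>x. (u x - s i x) * (indicator II x * \<psi> N x) \<partial>lborel\<bar> \<le> K * (\<integral>x. \<bar>u x - s i x\<bar> \<partial>lborel)"
          using lim(1,4) by (intro int(2)) auto
        ultimately show ?thesis using i N0[OF that] unfolding real_norm_def by linarith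
      qed
      then show "\<exists>N0. \<forall>N\<ge>N0. norm ((\<integral>x. u x * (indicator II x * \<psi> N x) \<partial>lborel) - 0) < e" by blast
    qed
  qed
qed

lemma space_acim: "is_acim t \<mu> \<Longrightarrow> space \<mu> = II"
  using sets_eq_imp_space_eq[of \<mu> "restrict_space borel II"] by (simp add: is_acim_def space_restrict_space)

lemma acim_measurable_borel:
  assumes "is_acim t \<mu>" "f \<in> borel_measurable borel" shows "f \<in> borel_measurable \<mu>"
  using assms by (simp add: is_acim_def measurable_restrict_space1 cong: measurable_cong_sets)

lemma acim_integrable:
  assumes "is_acim t \<mu>" "bdd_borel M \<phi>" shows "integrable \<mu> \<phi>"
proof -
  interpret prob_space \<mu> using assms by (simp add: is_acim_def)
  show ?thesis
    using acim_measurable_borel[OF assms(1)] bdd_borelD[OF assms(2)]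
    by (intro integrable_const_bound[of _ M]) auto
qed

lemma acim_invariant:
  assumes t: "t \<in> JJ" and \<mu>: "is_acim t \<mu>" and \<phi>: "bdd_borel M \<phi>"
  shows "(\<integral>x. \<phi> (tent t x) \<partial>\<mu>) = (\<integral>x. \<phi> x \<partial>\<mu>)"
proof -
  have s: "sets \<mu> = sets (restrict_space borel II)" and d: "distr \<mu> (restrict_space borel II) (tent t) = \<mu>"
    using \<mu> by (auto simp: is_acim_def)
  have m: "tent t \<in> measurable \<mu> (restrict_space borel II)"
    using tent_measurable_II[OF t] by (simp cong: measurable_cong_sets add: s)
  have "(\<integral>x. \<phi> x \<partial>\<mu>) = (\<integral>x. \<phi> x \<partial>distr \<mu> (restrict_space borel II) (tent t))" by (simp add: d)
  also have "\<dots> = (\<integral>x. \<phi> (tent t x) \<partial>\<mu>)"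
    using bdd_borelD(1)[OF \<phi>] by (intro integral_distr m measurable_restrict_space1)
  finally show ?thesis by simp
qed

lemma acim_birkhoff:
  assumes t: "t \<in> JJ" and \<mu>: "is_acim t \<mu>" and \<phi>: "bdd_borel M \<phi>" and N: "0 < N"
  shows "(\<integral>x. birkhoff t N \<phi> x \<partial>\<mu>) = (\<integral>x. \<phi> x \<partial>\<mu>)"
proof -
  have bb: "bdd_borel M (\<lambda>x. \<phi> ((tent t ^^ n) x))" for n
    by (rule bdd_borel_comp[OF \<phi> funpow_tent_measurable])
  have pow: "(\<integral>x. \<phi> ((tent t ^^ n) x) \<partial>\<mu>) = (\<integral>x. \<phi> x \<partial>\<mu>)" for n
  proof (induction n)
    case (Suc n)
    have "(\<integral>x. \<phi> ((tent t ^^ Suc n) x) \<partial>\<mu>) = (\<integral>x. \<phi> ((tent t ^^ n) (tent t x)) \<partial>\<mu>)"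
      by (simp add: funpow_swap1)
    then show ?case using acim_invariant[OF t \<mu> bb[of n]] Suc by simp
  qed simp
  show ?thesis unfolding birkhoff_def
    using N by (simp add: Bochner_Integration.integral_sum[OF acim_integrable[OF \<mu> bb]] pow)
qed

text \<open>The centred averages \<open>\<psi> N\<close> have integrals tending to 0 over every
  initial interval, hence also against the density \<open>g\<close> of \<open>\<mu>\<close>. By
  invariance their \<open>\<mu>\<close>-integral is that of \<open>\<phi>\<close> minus the Lebesgue
  mean of the average. As the approximating sequence does not involve \<open>\<mu>\<close>,
  uniqueness follows.\<close>

lemma acim_integral_tendsto:
  assumes t: "t \<in> JJ" and \<mu>: "is_acim t \<mu>" and \<phi>: "bdd_borel M \<phi>"
  shows "(\<lambda>N. intv (- 1) 1 (birkhoff t N \<phi>) / 2) \<longlonglongrightarrow> (\<integral>x. \<phi> x \<partial>\<mu>)"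
proof -
  interpret \<mu>: prob_space \<mu> using \<mu> by (simp add: is_acim_def)
  let ?L = "restrict_space lborel II"
  have sL: "sets ?L = sets (restrict_space borel II)" by (rule sets_restrict_space_cong) simp
  have s: "sets \<mu> = sets ?L" and ac: "absolutely_continuous ?L \<mu>"
    using \<mu> sL by (auto simp: is_acim_def)
  interpret L: sigma_finite_measure ?L
    by (rule sigma_finite_measure_restrict_space) (auto intro: sigma_finite_lborel)
  obtain D where D: "D \<in> borel_measurable ?L" "AE x in ?L. RN_deriv ?L \<mu> x = ennreal (D x)" "\<And>x. 0 \<le> D x"
    using L.real_RN_deriv[OF \<mu>.finite_measure_axioms ac s] by metis
  have dens: "\<mu> = density ?L (\<lambda>x. ennreal (D x))"
    using L.density_RN_deriv[OF ac s] density_cong[OF _ _ D(2)] D(1) by fastforce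
  define g where "g x = indicator II x * D x" for x
  have g_meas: "g \<in> borel_measurable lborel"
    unfolding g_def using D(1) borel_measurable_restrict_space_iff[of II lborel D] by simp
  have int_eq: "(\<integral>x. f x \<partial>\<mu>) = (\<integral>x. g x * f x \<partial>lborel)" if "f \<in> borel_measurable borel" for f
  proof -
    have "(\<integral>x. f x \<partial>\<mu>) = (\<integral>x. D x * f x \<partial>?L)"
      using that D unfolding dens by (subst integral_density) (auto intro: measurable_restrict_space1)
    also have "\<dots> = (\<integral>x. g x * f x \<partial>lborel)"
      by (subst integral_restrict_space) (auto simp: g_def mult.assoc)
    finally show ?thesis .
  qed
  have g1: "(\<integral>x. g x \<partial>lborel) = 1" using int_eq[of "\<lambda>_. 1"] \<mu>.prob_space by simp
  \<comment> \<open>A function that is not integrable has integral 0 by default, which the value 1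
    excludes.\<close>
  have g_int: "integrable lborel g" using g1 not_integrable_integral_eq by fastforce
  define \<psi> where "\<psi> N x = birkhoff t N \<phi> x + - (intv (- 1) 1 (birkhoff t N \<phi>) / 2)" for N x
  have A: "bdd_borel M (birkhoff t N \<phi>)" for N by (rule bdd_borel_birkhoff[OF \<phi>])
  have c: "bdd_borel M (\<lambda>_. - (intv (- 1) 1 (birkhoff t N \<phi>) / 2))" for N
    using birkhoff_integral_bound[OF \<phi>] by (simp add: bdd_borel_def)
  have \<psi>: "bdd_borel (M + M) (\<psi> N)" for N unfolding \<psi>_def by (rule bdd_borel_add[OF A c])
  have "(\<lambda>N. intv (- 1) z (\<psi> N)) \<longlonglongrightarrow> 0" if z: "z \<in> II" for z
  proof (rule Lim_null_comparison)
    have "intv (- 1) z (\<psi> N) = intv (- 1) z (birkhoff t N \<phi>) - (z + 1) / 2 * intv (- 1) 1 (birkhoff t N \<phi>)" for N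
      unfolding \<psi>_def intv_add[OF A c] using II_bounds[OF z] by (simp add: intv_const)
    then show "\<forall>\<^sub>F N in sequentially. norm (intv (- 1) z (\<psi> N)) \<le> 8 * M * (t / (t - 1)) / real N"
      using intv_birkhoff_equidistributed[OF t \<phi> z] by (intro always_eventually) (simp add: mult_ac)
    show "(\<lambda>N. 8 * M * (t / (t - 1)) / real N) \<longlonglongrightarrow> 0" by (rule lim_const_over_n)
  qed
  from equidistributed_integrable[OF \<psi> this g_int]
  have lim: "(\<lambda>N. \<integral>x. g x * (indicator II x * \<psi> N x) \<partial>lborel) \<longlonglongrightarrow> 0" .
  have "(\<integral>x. g x * (indicator II x * \<psi> N x) \<partial>lborel) = (\<integral>x. \<phi> x \<partial>\<mu>) - intv (- 1) 1 (birkhoff t N \<phi>) / 2" if "0 < N" for N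
  proof -
    have "(\<integral>x. g x * (indicator II x * \<psi> N x) \<partial>lborel) = (\<integral>x. g x * \<psi> N x \<partial>lborel)"
      by (intro Bochner_Integration.integral_cong) (auto simp: g_def indicator_def)
    also have "\<dots> = (\<integral>x. \<psi> N x \<partial>\<mu>)" using bdd_borelD(1)[OF \<psi>] by (simp add: int_eq)
    also have "\<dots> = (\<integral>x. birkhoff t N \<phi> x \<partial>\<mu>) + - (intv (- 1) 1 (birkhoff t N \<phi>) / 2)"
      unfolding \<psi>_def using acim_integrable[OF \<mu> A] \<mu>.prob_space
      by (subst Bochner_Integration.integral_add) auto
    finally show ?thesis using acim_birkhoff[OF t \<mu> \<phi> that] by simp
  qed
  then have "\<forall>\<^sub>F N in sequentially. (\<integral>x. g x * (indicator II x * \<psi> N x) \<partial>lborel) = (\<integral>x. \<phi> x \<partial>\<mu>) - intv (- 1) 1 (birkhoff t N \<phi>) / 2"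
    by (intro eventually_mono[OF eventually_gt_at_top[of 0]])
  from Lim_transform_eventually[OF lim this]
  have "(\<lambda>N. (\<integral>x. \<phi> x \<partial>\<mu>) - intv (- 1) 1 (birkhoff t N \<phi>) / 2) \<longlonglongrightarrow> 0" .
  from tendsto_diff[OF tendsto_const[of "\<integral>x. \<phi> x \<partial>\<mu>"] this] show ?thesis by simp
qed

lemma is_acim_unique:
  assumes t: "t \<in> JJ" and \<mu>: "is_acim t \<mu>" and \<nu>: "is_acim t \<nu>" shows "\<mu> = \<nu>"
proof (rule measure_eqI)
  show sets: "sets \<mu> = sets \<nu>" using \<mu> \<nu> by (simp add: is_acim_def)
  fix A assume "A \<in> sets \<mu>"
  then have A: "A \<in> sets borel" "A \<subseteq> II" using \<mu> by (auto simp: is_acim_def sets_restrict_space_iff)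
  interpret \<mu>: prob_space \<mu> using \<mu> by (simp add: is_acim_def)
  interpret \<nu>: prob_space \<nu> using \<nu> by (simp add: is_acim_def)
  have "(\<integral>x. indicator A x \<partial>\<mu>) = (\<integral>x. (indicator A x :: real) \<partial>\<nu>)"
    by (rule LIMSEQ_unique[OF acim_integral_tendsto[OF t \<mu> bdd_borel_indicator[OF A(1)]]
          acim_integral_tendsto[OF t \<nu> bdd_borel_indicator[OF A(1)]]])
  then show "emeasure \<mu> A = emeasure \<nu> A"
    using A by (simp add: \<mu>.emeasure_eq_measure \<nu>.emeasure_eq_measure space_acim[OF \<mu>] space_acim[OF \<nu>] Int_absorb2)
qed

lemma is_acim_acim: "t \<in> JJ \<Longrightarrow> is_acim t (acim t)"
  unfolding acim_def using theI[of "is_acim t", OF is_acim_tent_acim] is_acim_unique is_acim_tent_acim by blast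

lemma integral_acim:
  assumes "t \<in> JJ" "bdd_borel M \<phi>" shows "(\<integral>x. \<phi> x \<partial>acim t) = acim_mean t \<phi>"
  using integral_tent_acim[OF assms] is_acim_unique[OF assms(1) is_acim_acim is_acim_tent_acim] assms by simp

section \<open>Weak continuity of the invariant measure\<close>

lemma acim_mean_mix:
  assumes t: "t \<in> JJ" and \<phi>: "bdd_borel M \<phi>" and N: "0 < N" and c: "0 < c" "c \<le> \<bar>kint t 1 (\<lambda>_. 1)\<bar>"
  shows "\<bar>acim_mean t \<phi> - intv (- 1) 1 (birkhoff t N \<phi>) / 2\<bar> \<le> 8 * M / real N * (t / (t - 1))\<^sup>2 / c"
proof -
  let ?k = "kint t 1 (\<lambda>_. 1)"
  have k: "?k \<noteq> 0" using c by auto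
  have "\<bar>?k\<bar> * \<bar>acim_mean t \<phi> - intv (- 1) 1 (birkhoff t N \<phi>) / 2\<bar> = \<bar>kint t 1 \<phi> - ?k / 2 * intv (- 1) 1 (birkhoff t N \<phi>)\<bar>"
    unfolding abs_mult[symmetric] using k by (simp add: acim_mean_def right_diff_distrib)
  also have "\<dots> \<le> 8 * M / real N * (t / (t - 1))\<^sup>2" by (rule kint_1_mix[OF t \<phi> N])
  finally have "c * \<bar>acim_mean t \<phi> - intv (- 1) 1 (birkhoff t N \<phi>) / 2\<bar> \<le> 8 * M / real N * (t / (t - 1))\<^sup>2"
    using mult_right_mono[OF c(2) abs_ge_zero] order.trans by blast
  then show ?thesis unfolding pos_le_divide_eq[OF c(1)] by (simp only: mult.commute[of c])
qed

text \<open>The observable varies with the slope. Convergence along convergent sequences of points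
  is a form of joint continuity that can be evaluated along the orbits of
  \<open>tent (ts i)\<close>; dominated convergence does the rest.\<close>

lemma birkhoff_tendsto:
  assumes "\<And>\<xi> x. x \<in> II \<Longrightarrow> (\<And>i. \<xi> i \<in> II) \<Longrightarrow> \<xi> \<longlonglongrightarrow> x \<Longrightarrow> (\<lambda>i. \<phi> i (\<xi> i)) \<longlonglongrightarrow> \<phi>0 x"
    and ts: "\<And>i. ts i \<in> JJ" "t0 \<in> JJ" "ts \<longlonglongrightarrow> t0"
    and b: "\<And>i. bdd_borel M (\<phi> i)" "bdd_borel M \<phi>0"
  shows "(\<lambda>i. intv (- 1) 1 (birkhoff (ts i) N (\<phi> i))) \<longlonglongrightarrow> intv (- 1) 1 (birkhoff t0 N \<phi>0)"
  unfolding intv_def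
proof (rule integral_dominated_convergence)
  note A = bdd_borel_birkhoff[OF b(1)] bdd_borel_birkhoff[OF b(2)]
  show "(\<lambda>x. indicator {- 1..1} x * birkhoff t0 N \<phi>0 x) \<in> borel_measurable lborel"
    "(\<lambda>x. indicator {- 1..1} x * birkhoff (ts i) N (\<phi> i) x) \<in> borel_measurable lborel" for i
    using bdd_borelD(1)[OF A(1)] bdd_borelD(1)[OF A(2)] by auto
  show "integrable lborel (\<lambda>x. M * indicator {- 1..1::real} x)" by (rule integrable_indicator_Icc)
  show "AE x in lborel. norm (indicator {- 1..1} x * birkhoff (ts i) N (\<phi> i) x) \<le> M * indicator {- 1..1} x" for i
    using bdd_borelD(2)[OF A(1)] by (intro AE_I2) (auto simp: indicator_def)
  have "(\<lambda>i. birkhoff (ts i) N (\<phi> i) x) \<longlonglongrightarrow> birkhoff t0 N \<phi>0 x" if x: "x \<in> II" for x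
    unfolding birkhoff_def divide_inverse
    by (rule tendsto_mult[OF tendsto_sum tendsto_const],
        rule assms(1)[OF funpow_in_II[OF ts(2) x] funpow_in_II[OF ts(1) x] tendsto_funpow_tent[OF ts(3) tendsto_const]])
  then show "AE x in lborel. (\<lambda>i. indicator {- 1..1} x * birkhoff (ts i) N (\<phi> i) x) \<longlonglongrightarrow> indicator {- 1..1} x * birkhoff t0 N \<phi>0 x"
    by (intro AE_I2) (auto simp: indicator_def II_def)
qed

text \<open>For fixed \<open>N\<close> the Lebesgue means of the Birkhoff averages converge by
  \<open>birkhoff_tendsto\<close>. They differ from the invariant means by at most
  \<open>B / N\<close>, uniformly near \<open>t0\<close> thanks to \<open>kint_mass_lower\<close>.
  The observables depend on \<open>i\<close> because those coming from the fat inverse limit depend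
  on the slope.\<close>

proposition acim_tendsto:
  assumes cont: "\<And>\<xi> x. x \<in> II \<Longrightarrow> (\<And>i. \<xi> i \<in> II) \<Longrightarrow> \<xi> \<longlonglongrightarrow> x \<Longrightarrow> (\<lambda>i. \<phi> i (\<xi> i)) \<longlonglongrightarrow> \<phi>0 x"
    and ts: "\<And>i. ts i \<in> JJ" "t0 \<in> JJ" "ts \<longlonglongrightarrow> t0"
    and b: "\<And>i. bdd_borel M (\<phi> i)" "bdd_borel M \<phi>0"
  shows "(\<lambda>i. \<integral>x. \<phi> i x \<partial>acim (ts i)) \<longlonglongrightarrow> (\<integral>x. \<phi>0 x \<partial>acim t0)"
proof -
  obtain c where c: "0 < c" "\<forall>\<^sub>F t in nhds t0. t \<in> JJ \<longrightarrow> c \<le> \<bar>kint t 1 (\<lambda>_. 1)\<bar>"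
    using kint_mass_lower[OF ts(2)] .
  obtain r where r: "1 < r" "\<forall>\<^sub>F t in nhds t0. r < t" using JJ_neighbourhood[OF ts(2)] .
  define B where "B = 8 * M * (2 / (r - 1))\<^sup>2 / c"
  have M: "0 \<le> M" using bdd_borel_nonneg[OF b(2)] .
  have unif: "\<bar>acim_mean t \<phi> - intv (- 1) 1 (birkhoff t N \<phi>) / 2\<bar> \<le> B / real N"
    if t: "t \<in> JJ" "c \<le> \<bar>kint t 1 (\<lambda>_. 1)\<bar>" "r < t" and \<phi>: "bdd_borel M \<phi>" and N: "0 < N" for t \<phi> N
  proof -
    have "t / (t - 1) \<le> 2 / (r - 1)" using JJ_D[OF t(1)] r(1) t(3) by (intro frac_le) auto
    then have "(t / (t - 1))\<^sup>2 \<le> (2 / (r - 1))\<^sup>2" using JJ_D[OF t(1)] by (intro power_mono) auto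
    then have "8 * M / real N * (t / (t - 1))\<^sup>2 / c \<le> 8 * M / real N * (2 / (r - 1))\<^sup>2 / c"
      using c(1) M by (intro divide_right_mono mult_left_mono) auto
    then show ?thesis using acim_mean_mix[OF t(1) \<phi> N c(1) t(2)] by (simp add: B_def mult_ac)
  qed
  have ev: "\<forall>\<^sub>F i in sequentially. ts i \<in> JJ \<and> c \<le> \<bar>kint (ts i) 1 (\<lambda>_. 1)\<bar> \<and> r < ts i"
    using eventually_compose_filterlim[OF c(2) ts(3)] eventually_compose_filterlim[OF r(2) ts(3)]
    by eventually_elim (use ts(1) in auto)
  \<comment> \<open>A property that holds near \<open>t0\<close> holds at \<open>t0\<close>, so the
    uniform estimate covers the limit as well.\<close>
  have t0: "c \<le> \<bar>kint t0 1 (\<lambda>_. 1)\<bar>" "r < t0"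
    using eventually_nhds_x_imp_x[OF c(2)] eventually_nhds_x_imp_x[OF r(2)] ts(2) by auto
  have "(\<lambda>i. acim_mean (ts i) (\<phi> i)) \<longlonglongrightarrow> acim_mean t0 \<phi>0"
  proof (rule metric_LIMSEQ_I)
    fix e :: real assume e: "0 < e"
    have "(\<lambda>N. B / real N) \<longlonglongrightarrow> 0" by (rule lim_const_over_n)
    then have "\<forall>\<^sub>F N in sequentially. B / real N < e / 3 \<and> 0 < N"
      using e by (intro eventually_conj order_tendstoD eventually_gt_at_top) auto
    then obtain N where N: "B / real N < e / 3" "0 < N" by (auto simp: eventually_sequentially)
    have "(\<lambda>i. intv (- 1) 1 (birkhoff (ts i) N (\<phi> i)) / 2) \<longlonglongrightarrow> intv (- 1) 1 (birkhoff t0 N \<phi>0) / 2"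
      by (intro tendsto_divide birkhoff_tendsto[OF cont ts b] tendsto_const) auto
    then have "\<forall>\<^sub>F i in sequentially. dist (intv (- 1) 1 (birkhoff (ts i) N (\<phi> i)) / 2) (intv (- 1) 1 (birkhoff t0 N \<phi>0) / 2) < e / 3"
      using e by (intro tendstoD) auto
    with ev have "\<forall>\<^sub>F i in sequentially. dist (acim_mean (ts i) (\<phi> i)) (acim_mean t0 \<phi>0) < e"
    proof eventually_elim
      case (elim i)
      have 1: "\<bar>acim_mean (ts i) (\<phi> i) - intv (- 1) 1 (birkhoff (ts i) N (\<phi> i)) / 2\<bar> < e / 3"
        using unif[OF _ _ _ b(1)[of i] N(2), of "ts i"] elim N(1) by linarith
      have 2: "\<bar>acim_mean t0 \<phi>0 - intv (- 1) 1 (birkhoff t0 N \<phi>0) / 2\<bar> < e / 3"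
        using unif[OF ts(2) t0 b(2) N(2)] N(1) by linarith
      have tri: "\<bar>a - d\<bar> < e" if "\<bar>a - b\<bar> < e / 3" "\<bar>d - c\<bar> < e / 3" "\<bar>b - c\<bar> < e / 3" for a b c d :: real
        using that by linarith
      show ?case using tri[OF 1 2] elim(2) by (simp add: dist_real_def)
    qed
    then show "\<exists>n0. \<forall>i\<ge>n0. dist (acim_mean (ts i) (\<phi> i)) (acim_mean t0 \<phi>0) < e"
      by (simp add: eventually_sequentially)
  qed
  then show ?thesis using integral_acim[OF ts(1) b(1)] integral_acim[OF ts(2) b(2)] by simp
qed

section \<open>The natural extension measure\<close>

context
  fixes X :: "real set" and f :: "real \<Rightarrow> real" and \<nu> :: "real measure"
  assumes X: "X \<in> sets borel" and f: "f \<in> borel_measurable borel"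
    and f_X: "\<And>x. x \<in> X \<Longrightarrow> f x \<in> X"
    and prob_\<nu>: "prob_space \<nu>" and sets_\<nu>: "sets \<nu> = sets (restrict_space borel X)"
    and inv_\<nu>: "distr \<nu> (restrict_space borel X) f = \<nu>"
begin

section \<open>Measurable structure of the inverse limit\<close>

lemma funpow_borel: "(f ^^ n) \<in> borel_measurable borel"
proof (induction n)
  case (Suc n)
  then show ?case using measurable_compose[OF Suc f] by (simp add: comp_def)
qed (simp add: id_def)

lemma image_coordinate_measurable: "(\<lambda>x. f (x n)) \<in> borel_measurable borel"
  by (rule measurable_compose[OF measurable_product_coordinates f])

lemma coordinate_relation_sets: "{x. f (x (Suc n)) = x n} \<in> sets (borel :: (nat \<Rightarrow> real) measure)"
  using borel_measurable_eq[OF image_coordinate_measurable measurable_product_coordinates, of "Suc n" n] by simp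

lemma coordinate_in_sets: "A \<in> sets borel \<Longrightarrow> {x. x n \<in> A} \<in> sets (borel :: (nat \<Rightarrow> real) measure)"
  using measurable_sets[OF measurable_product_coordinates, of A n] by (simp add: vimage_def)

lemma invlim_sets: "invlim X f \<in> sets borel"
proof -
  have "invlim X f = (\<Inter>n. {x. x n \<in> X}) \<inter> (\<Inter>n. {x. f (x (Suc n)) = x n})"
    by (auto simp: invlim_def)
  then show ?thesis
    using coordinate_relation_sets coordinate_in_sets[OF X] by (auto intro!: sets.Int sets.countable_INT)
qed

lemma invlim_funpow:
  assumes "x \<in> invlim X f" shows "(f ^^ k) (x (k + j)) = x j"
proof (induction k)
  case (Suc k)
  have "f (x (Suc (k + j))) = x (k + j)" using assms by (simp add: invlim_def)
  then show ?case using Suc by (simp add: funpow_swap1)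
qed simp

lemma natext_invlim: "x \<in> invlim X f \<Longrightarrow> natext f x \<in> invlim X f"
  by (auto simp: invlim_def natext_def f_X split: nat.split)

lemma natext_measurable: "natext f \<in> measurable (restrict_space borel (invlim X f)) (restrict_space borel (invlim X f))"
proof (rule measurable_restrict_space3)
  show "natext f \<in> measurable borel borel"
  proof (rule measurable_coordinatewise_then_product)
    fix n show "(\<lambda>x. natext f x n) \<in> borel_measurable borel"
      using image_coordinate_measurable measurable_product_coordinates by (cases n) (simp_all add: natext_def)
  qed
qed (use natext_invlim in auto)

lemma coordinate_measurable:
  "(\<lambda>x. x n) \<in> measurable (restrict_space borel (invlim X f)) (restrict_space borel X)"
  by (rule measurable_restrict_space3[OF measurable_product_coordinates]) (auto simp: invlim_def)

text \<open>On the inverse limit the coordinate \<open>x n\<close> determines all earlier ones, so a measure is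
  determined by its one-dimensional marginals.\<close>

lemma invlim_cylinder_measure:
  assumes N: "sets N = sets (restrict_space borel (invlim X f))"
    and marg: "\<And>n. distr N (restrict_space borel X) (\<lambda>x. x n) = \<nu>"
    and J: "finite J" "\<And>j. j \<in> J \<Longrightarrow> A j \<in> sets borel" "\<And>j. j \<in> J \<Longrightarrow> j \<le> n"
  shows "emeasure N {x \<in> invlim X f. \<forall>j\<in>J. x j \<in> A j} = emeasure \<nu> {y \<in> X. \<forall>j\<in>J. (f ^^ (n - j)) y \<in> A j}"
proof -
  have spN: "space N = invlim X f"
    using sets_eq_imp_space_eq[OF N] by (simp add: space_restrict_space)
  have m: "(\<lambda>x. x n) \<in> measurable N (restrict_space borel X)"
    using coordinate_measurable by (simp cong: measurable_cong_sets add: N)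
  have B: "{y \<in> X. \<forall>j\<in>J. (f ^^ (n - j)) y \<in> A j} \<in> sets (restrict_space borel X)"
  proof -
    have "{y. \<forall>j\<in>J. (f ^^ (n - j)) y \<in> A j} = (\<Inter>j\<in>J. (f ^^ (n - j)) -` A j \<inter> space borel) \<inter> UNIV" by auto
    moreover have "(f ^^ (n - j)) -` A j \<inter> space borel \<in> sets borel" if "j \<in> J" for j
      by (rule measurable_sets[OF funpow_borel J(2)[OF that]])
    ultimately have "{y. \<forall>j\<in>J. (f ^^ (n - j)) y \<in> A j} \<in> sets borel"
      using J(1) by (cases "J = {}") (auto intro!: sets.finite_INT)
    then have "X \<inter> {y. \<forall>j\<in>J. (f ^^ (n - j)) y \<in> A j} \<in> sets (restrict_space borel X)"
      by (auto simp: sets_restrict_space)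
    moreover have "X \<inter> {y. \<forall>j\<in>J. (f ^^ (n - j)) y \<in> A j} = {y \<in> X. \<forall>j\<in>J. (f ^^ (n - j)) y \<in> A j}" by auto
    ultimately show ?thesis by simp
  qed
  have "x j = (f ^^ (n - j)) (x n)" if "x \<in> invlim X f" "j \<in> J" for x j
    using invlim_funpow[OF that(1), of "n - j" j] J(3)[OF that(2)] by simp
  then have "{x \<in> invlim X f. \<forall>j\<in>J. x j \<in> A j} = (\<lambda>x. x n) -` {y \<in> X. \<forall>j\<in>J. (f ^^ (n - j)) y \<in> A j} \<inter> space N"
    by (auto simp: spN) (auto simp: invlim_def)
  then have "emeasure N {x \<in> invlim X f. \<forall>j\<in>J. x j \<in> A j} = emeasure (distr N (restrict_space borel X) (\<lambda>x. x n)) {y \<in> X. \<forall>j\<in>J. (f ^^ (n - j)) y \<in> A j}"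
    by (simp add: emeasure_distr[OF m B])
  then show ?thesis by (simp add: marg)
qed

text \<open>Pushed forward to the product sigma-algebra, both measures agree on finite cylinders by
  \<open>invlim_cylinder_measure\<close>, and these generate it and are stable under
  intersection.\<close>

lemma invlim_measure_unique:
  assumes N1: "prob_space N1" "sets N1 = sets (restrict_space borel (invlim X f))"
      "\<And>n. distr N1 (restrict_space borel X) (\<lambda>x. x n) = \<nu>"
    and N2: "prob_space N2" "sets N2 = sets (restrict_space borel (invlim X f))"
      "\<And>n. distr N2 (restrict_space borel X) (\<lambda>x. x n) = \<nu>"
  shows "N1 = N2"
proof -
  let ?P = "Pi\<^sub>M (UNIV :: nat set) (\<lambda>_. borel :: real measure)"
  let ?S = "invlim X f"
  have sP: "sets ?P = sets borel" by (rule sets_PiM_equal_borel)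
  have meas: "(\<lambda>x. x) \<in> measurable N ?P" if "sets N = sets (restrict_space borel ?S)" for N
    using measurable_restrict_space1[OF measurable_ident, of borel ?S]
    by (simp cong: measurable_cong_sets add: that sP id_def)
  have sp: "space N = ?S" if "sets N = sets (restrict_space borel ?S)" for N
    using sets_eq_imp_space_eq[OF that] by (simp add: space_restrict_space)
  \<comment> \<open>Inserting 0 gives an upper bound of \<open>J\<close> that is also defined when
    \<open>J\<close> is empty.\<close>
  have cyl: "emeasure (distr N ?P (\<lambda>x. x)) (prod_emb UNIV (\<lambda>_. borel) J (Pi\<^sub>E J A))
      = emeasure \<nu> {y \<in> X. \<forall>j\<in>J. (f ^^ (Max (insert 0 J) - j)) y \<in> A j}"
    if N: "sets N = sets (restrict_space borel ?S)" "\<And>n. distr N (restrict_space borel X) (\<lambda>x. x n) = \<nu>"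
      and J: "finite J" "\<And>i. i \<in> J \<Longrightarrow> A i \<in> sets borel" for N J and A :: "nat \<Rightarrow> real set"
  proof -
    have "prod_emb UNIV (\<lambda>_. borel) J (Pi\<^sub>E J A) \<in> sets ?P" using J by (intro sets_PiM_I) auto
    then have "emeasure (distr N ?P (\<lambda>x. x)) (prod_emb UNIV (\<lambda>_. borel) J (Pi\<^sub>E J A))
        = emeasure N (prod_emb UNIV (\<lambda>_. borel) J (Pi\<^sub>E J A) \<inter> ?S)"
      by (subst emeasure_distr[OF meas[OF N(1)]]) (simp_all add: sp[OF N(1)])
    also have "prod_emb UNIV (\<lambda>_. borel) J (Pi\<^sub>E J A) \<inter> ?S = {x \<in> ?S. \<forall>j\<in>J. x j \<in> A j}"
      by (auto simp: prod_emb_def PiE_def Pi_def extensional_def)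
    also have "emeasure N \<dots> = emeasure \<nu> {y \<in> X. \<forall>j\<in>J. (f ^^ (Max (insert 0 J) - j)) y \<in> A j}"
      using J by (intro invlim_cylinder_measure[OF N]) auto
    finally show ?thesis .
  qed
  have eq: "distr N1 ?P (\<lambda>x. x) = distr N2 ?P (\<lambda>x. x)"
  proof (rule measure_eqI_PiM_infinite)
    show "finite_measure (distr N1 ?P (\<lambda>x. x))"
      using prob_space.prob_space_distr[OF N1(1) meas[OF N1(2)]] by (rule prob_space.finite_measure)
  qed (use cyl[OF N1(2,3)] cyl[OF N2(2,3)] in auto)
  show ?thesis
  proof (rule measure_eqI)
    show "sets N1 = sets N2" using N1 N2 by simp
    fix A assume A: "A \<in> sets N1"
    then have "A \<in> sets borel" "A \<subseteq> ?S" using invlim_sets by (auto simp: N1(2) sets_restrict_space_iff)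
    then have "emeasure (distr N ?P (\<lambda>x. x)) A = emeasure N A" if "sets N = sets (restrict_space borel ?S)" for N
      using that by (subst emeasure_distr[OF meas[OF that]]) (auto simp: sP sp[OF that] Int_absorb2)
    then show "emeasure N1 A = emeasure N2 A" using eq N1(2) N2(2) by metis
  qed
qed

text \<open>Extending \<open>\<nu>\<close> by zero outside \<open>X\<close> gives a law on the whole
  line, a Polish space, to which Kolmogorov's theorem applies.\<close>

lemma borel_extension:
  shows "prob_space (distr \<nu> borel (\<lambda>x. x))" "distr (distr \<nu> borel (\<lambda>x. x)) borel f = distr \<nu> borel (\<lambda>x. x)"
    "\<And>A. A \<in> sets borel \<Longrightarrow> emeasure (distr \<nu> borel (\<lambda>x. x)) A = emeasure \<nu> (A \<inter> X)"
proof -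
  have sp: "space \<nu> = X" using sets_eq_imp_space_eq[OF sets_\<nu>] by (simp add: space_restrict_space)
  have id: "(\<lambda>x. x) \<in> measurable (restrict_space borel X) borel"
    using measurable_restrict_space1[OF measurable_ident, of borel X] by (simp add: id_def)
  have id': "(\<lambda>x. x) \<in> measurable \<nu> borel" using id by (simp cong: measurable_cong_sets add: sets_\<nu>)
  have fr: "f \<in> measurable (restrict_space borel X) (restrict_space borel X)"
    by (rule measurable_restrict_space3[OF f]) (use f_X in auto)
  have fr': "f \<in> measurable \<nu> (restrict_space borel X)" using fr by (simp cong: measurable_cong_sets add: sets_\<nu>)
  show "prob_space (distr \<nu> borel (\<lambda>x. x))" by (rule prob_space.prob_space_distr[OF prob_\<nu> id'])
  show "distr (distr \<nu> borel (\<lambda>x. x)) borel f = distr \<nu> borel (\<lambda>x. x)"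
    using distr_distr[OF f id'] distr_distr[OF id fr'] by (simp add: inv_\<nu> comp_def)
  show "emeasure (distr \<nu> borel (\<lambda>x. x)) A = emeasure \<nu> (A \<inter> X)" if "A \<in> sets borel" for A
    using that by (subst emeasure_distr[OF id']) (auto simp: sp)
qed

text \<open>Kolmogorov extension: the coordinates \<open>j\<close> in a finite set \<open>J\<close>
  receive the joint law of \<open>(f ^^ (Max J - j)) y\<close>, with \<open>y\<close> distributed as
  \<open>\<nu>\<close>. Invariance of \<open>\<nu>\<close> makes these laws consistent.\<close>

lemma exists_kolmogorov_measure:
  obtains L :: "(nat \<Rightarrow> real) measure"
  where "prob_space L" "sets L = sets borel"
    "\<And>n A. A \<in> sets borel \<Longrightarrow> emeasure L {x. x n \<in> A} = emeasure \<nu> (A \<inter> X)"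
    "\<And>n. AE x in L. f (x (Suc n)) = x n"
proof -
  define \<nu>' where "\<nu>' = distr \<nu> borel (\<lambda>x. x)"
  have p: "prob_space \<nu>'" and inv: "distr \<nu>' borel f = \<nu>'"
    and em: "\<And>A. A \<in> sets borel \<Longrightarrow> emeasure \<nu>' A = emeasure \<nu> (A \<inter> X)"
    using borel_extension by (auto simp: \<nu>'_def)
  have s': "sets \<nu>' = sets borel" by (simp add: \<nu>'_def)
  have fb: "(f ^^ n) \<in> measurable \<nu>' borel" for n
    using funpow_borel by (simp cong: measurable_cong_sets add: s')
  have inv_n: "distr \<nu>' borel (f ^^ n) = \<nu>'" for n
  proof (induction n)
    case 0
    show ?case using distr_id2[OF s'[symmetric]] by (simp add: id_def)
  next
    case (Suc n)
    have "distr \<nu>' borel (f ^^ Suc n) = distr (distr \<nu>' borel (f ^^ n)) borel f"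
      by (simp add: distr_distr[OF f fb])
    then show ?case by (simp only: Suc inv)
  qed
  define h where "h J k x = (\<lambda>j\<in>J. (f ^^ (k - j)) x)" for J and k :: nat and x
  define P where "P J = distr \<nu>' (Pi\<^sub>M J (\<lambda>_. borel)) (h J (Max J))" for J
  have hm: "h J k \<in> measurable borel (Pi\<^sub>M J (\<lambda>_. borel))" for J k
    unfolding h_def[abs_def] by (intro measurable_restrict funpow_borel)
  have hm': "h J k \<in> measurable \<nu>' (Pi\<^sub>M J (\<lambda>_. borel))" for J k
    using hm by (simp cong: measurable_cong_sets add: s')
  interpret polish_projective UNIV P
  proof (rule polish_projective.intro, rule projective_family.intro)
    fix J H :: "nat set" assume JH: "J \<subseteq> H" "finite H"
    have "distr (P H) (Pi\<^sub>M J (\<lambda>_. borel)) (\<lambda>f. restrict f J) = distr \<nu>' (Pi\<^sub>M J (\<lambda>_. borel)) ((\<lambda>f. restrict f J) \<circ> h H (Max H))"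
      unfolding P_def by (intro distr_distr measurable_restrict_subset JH hm')
    also have "(\<lambda>f. restrict f J) \<circ> h H (Max H) = h J (Max H)"
      using JH(1) by (auto simp: h_def fun_eq_iff)
    also have "distr \<nu>' (Pi\<^sub>M J (\<lambda>_. borel)) (h J (Max H)) = P J"
    proof (cases "J = {}")
      case True
      \<comment> \<open>For empty \<open>J\<close> the value of \<open>Max J\<close> is unspecified,
        but \<open>h\<close> then does not depend on it.\<close>
      have "h {} k = h {} l" for k l by (auto simp: h_def fun_eq_iff)
      then show ?thesis unfolding P_def True by metis
    next
      case False
      then have "finite J" "Max J \<le> Max H" using JH by (auto intro: finite_subset Max_mono)
      \<comment> \<open>Starting from coordinate \<open>Max H\<close> instead of
        \<open>Max J\<close> precomposes with an iterate of \<open>f\<close>, which the invariant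
        law absorbs.\<close>
      have "h J (Max H) = h J (Max J) \<circ> (f ^^ (Max H - Max J))"
      proof (rule ext, rule ext)
        fix x j
        show "h J (Max H) x j = (h J (Max J) \<circ> (f ^^ (Max H - Max J))) x j"
        proof (cases "j \<in> J")
          case True
          then have "Max H - j = (Max J - j) + (Max H - Max J)"
            using \<open>finite J\<close> \<open>Max J \<le> Max H\<close> Max_ge[of J j] by simp
          then show ?thesis using True by (simp add: h_def funpow_add)
        qed (simp add: h_def)
      qed
      then have "distr \<nu>' (Pi\<^sub>M J (\<lambda>_. borel)) (h J (Max H)) = distr (distr \<nu>' borel (f ^^ (Max H - Max J))) (Pi\<^sub>M J (\<lambda>_. borel)) (h J (Max J))"
        by (simp add: distr_distr[OF hm fb])
      then show ?thesis by (simp add: inv_n P_def)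
    qed
    finally show "P J = distr (P H) (Pi\<^sub>M J (\<lambda>_. borel)) (\<lambda>f. restrict f J)" by (rule sym)
  next
    fix J :: "nat set" assume "finite J"
    show "prob_space (P J)" unfolding P_def by (rule prob_space.prob_space_distr[OF p hm'])
  qed
  have lim_emb: "emeasure lim {x. restrict x J \<in> B} = emeasure \<nu>' {y. h J (Max J) y \<in> B}"
    if "finite J" "B \<in> sets (Pi\<^sub>M J (\<lambda>_. borel))" for J B
  proof -
    have "emb UNIV J B = {x. restrict x J \<in> B}" by (auto simp: prod_emb_def)
    then have "emeasure lim {x. restrict x J \<in> B} = emeasure (P J) B"
      using emeasure_lim_emb[OF _ that] by simp
    also have "\<dots> = emeasure \<nu>' {y. h J (Max J) y \<in> B}"
      unfolding P_def using sets_eq_imp_space_eq[OF s'] by (subst emeasure_distr[OF hm' that(2)]) (simp add: vimage_def)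
    finally show ?thesis .
  qed
  show ?thesis
  proof
    show "prob_space lim" by (rule P.prob_space_axioms)
    show sl: "sets lim = sets borel" by (simp add: sets_PiM_equal_borel)
    show "emeasure lim {x. x n \<in> A} = emeasure \<nu> (A \<inter> X)" if A: "A \<in> sets borel" for n A
    proof -
      have B: "(\<lambda>x. x n) -` A \<inter> space (Pi\<^sub>M {n} (\<lambda>_. borel :: real measure)) \<in> sets (Pi\<^sub>M {n} (\<lambda>_. borel))"
        by (rule measurable_sets[OF _ A]) (simp add: measurable_component_singleton)
      from lim_emb[OF _ this] show ?thesis
        by (simp add: space_PiM h_def em[OF A])
    qed
    show "AE x in lim. f (x (Suc n)) = x n" for n
    proof -
      define J where "J = {n, Suc n}"
      have mJ: "(\<lambda>x. x n) \<in> measurable (Pi\<^sub>M J (\<lambda>_. borel)) borel" "(\<lambda>x. f (x (Suc n))) \<in> measurable (Pi\<^sub>M J (\<lambda>_. borel)) borel"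
        by (auto simp: J_def intro!: measurable_component_singleton measurable_compose[OF _ f])
      have B: "{x \<in> space (Pi\<^sub>M J (\<lambda>_. borel)). f (x (Suc n)) \<noteq> x n} \<in> sets (Pi\<^sub>M J (\<lambda>_. borel))"
        by (rule borel_measurable_neq[OF mJ(2,1)])
      \<comment> \<open>The joint law of the coordinates \<open>n\<close> and \<open>Suc n\<close>
        is that of \<open>(f y, y)\<close>, so the relation fails only on a null set.\<close>
      have "h J (Max J) y (Suc n) = y" "h J (Max J) y n = f y" for y by (auto simp: h_def J_def)
      then have "emeasure lim {x. restrict x J \<in> {x \<in> space (Pi\<^sub>M J (\<lambda>_. borel)). f (x (Suc n)) \<noteq> x n}} = 0"
        using lim_emb[OF _ B] by (simp add: J_def)
      moreover have "{x. restrict x J \<in> {x \<in> space (Pi\<^sub>M J (\<lambda>_. borel)). f (x (Suc n)) \<noteq> x n}} = {x. f (x (Suc n)) \<noteq> x n}"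
        by (auto simp: space_PiM J_def)
      ultimately have 0: "emeasure lim {x. f (x (Suc n)) \<noteq> x n} = 0" by simp
      have "- {x. f (x (Suc n)) = x n} \<in> sets borel" using coordinate_relation_sets[of n] by (rule borel_comp)
      then have "{x. f (x (Suc n)) \<noteq> x n} \<in> sets lim" unfolding sl by (simp add: Collect_neg_eq)
      then show ?thesis using 0 by (intro AE_I[of _ _ "{x. f (x (Suc n)) \<noteq> x n}"]) auto
    qed
  qed
qed

text \<open>The inverse limit is cut out by countably many conditions that hold almost surely for
  the Kolmogorov measure, which can therefore be restricted to it.\<close>

lemma exists_invlim_measure:
  obtains N where "prob_space N" "sets N = sets (restrict_space borel (invlim X f))"
    "\<And>n. distr N (restrict_space borel X) (\<lambda>x. x n) = \<nu>"
proof -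
  obtain L :: "(nat \<Rightarrow> real) measure" where L: "prob_space L" "sets L = sets borel"
    "\<And>n A. A \<in> sets borel \<Longrightarrow> emeasure L {x. x n \<in> A} = emeasure \<nu> (A \<inter> X)"
    "\<And>n. AE x in L. f (x (Suc n)) = x n"
    by (rule exists_kolmogorov_measure) blast
  interpret L: prob_space L by (rule L)
  let ?S = "invlim X f"
  have spL: "space L = UNIV" using sets_eq_imp_space_eq[OF L(2)] by simp
  have spn: "space \<nu> = X" using sets_eq_imp_space_eq[OF sets_\<nu>] by (simp add: space_restrict_space)
  have "AE x in L. x n \<in> X" for n
  proof (rule AE_I)
    have "emeasure L {x. x n \<in> - X} = 0" using L(3)[of "- X" n] X by simp
    then show "emeasure L {x. x n \<in> - X} = 0" .
    show "{x. x n \<in> - X} \<in> sets L"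
      unfolding L(2) using X by (intro coordinate_in_sets) auto
  qed auto
  then have AE_S: "AE x in L. x \<in> ?S" unfolding invlim_def using L(4) by (simp add: AE_all_countable)
  have S: "?S \<in> sets L" using invlim_sets L(2) by simp
  define N where "N = restrict_space L ?S"
  have sN: "sets N = sets (restrict_space borel ?S)" unfolding N_def by (rule sets_restrict_space_cong[OF L(2)])
  have em: "emeasure N (A \<inter> ?S) = emeasure L A" if "A \<in> sets L" for A
  proof -
    have "emeasure N (A \<inter> ?S) = emeasure L (A \<inter> ?S)"
      unfolding N_def using S by (subst emeasure_restrict_space) auto
    also have "\<dots> = emeasure L A" using AE_S that S by (intro emeasure_eq_AE) auto
    finally show ?thesis .
  qed
  have spN: "space N = ?S" by (simp add: N_def space_restrict_space spL)
  show ?thesis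
  proof
    show "prob_space N" using em[OF sets.top] by (intro prob_spaceI) (simp add: spN spL L.emeasure_space_1[unfolded spL])
    show "sets N = sets (restrict_space borel ?S)" by (rule sN)
    have m: "(\<lambda>x. x n) \<in> measurable N (restrict_space borel X)" for n
      using coordinate_measurable by (simp cong: measurable_cong_sets add: sN)
    show "distr N (restrict_space borel X) (\<lambda>x. x n) = \<nu>" for n
    proof (rule measure_eqI)
      fix A assume "A \<in> sets (distr N (restrict_space borel X) (\<lambda>x. x n))"
      then have A: "A \<in> sets (restrict_space borel X)" by simp
      then have A': "A \<in> sets borel" "A \<subseteq> X" using X by (auto simp: sets_restrict_space_iff)
      have "{x. x n \<in> A} \<in> sets L" unfolding L(2) by (rule coordinate_in_sets[OF A'(1)])
      then show "emeasure (distr N (restrict_space borel X) (\<lambda>x. x n)) A = emeasure \<nu> A"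
        using em[of "{x. x n \<in> A}"] L(3)[OF A'(1), of n] A'(2)
        by (simp add: emeasure_distr[OF m A] spN vimage_def Int_absorb2)
    qed (simp add: sets_\<nu>)
  qed
qed

text \<open>Existence and uniqueness resolve the definite description. Its invariance clause comes
  from uniqueness too: the image under \<open>natext f\<close> has the same marginals, at coordinate
  0 by invariance of \<open>\<nu>\<close> and at later ones by the shift.\<close>

lemma natext_measure_characterization:
  shows "prob_space (natext_measure X f \<nu>)"
    "sets (natext_measure X f \<nu>) = sets (restrict_space borel (invlim X f))"
    "distr (natext_measure X f \<nu>) (restrict_space borel X) (\<lambda>x. x n) = \<nu>"
proof -
  obtain N where N: "prob_space N" "sets N = sets (restrict_space borel (invlim X f))"
    "\<And>n. distr N (restrict_space borel X) (\<lambda>x. x n) = \<nu>"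
    by (rule exists_invlim_measure) blast
  let ?S = "invlim X f"
  have cm: "(\<lambda>x. x n) \<in> measurable N (restrict_space borel X)" for n
    using coordinate_measurable by (simp cong: measurable_cong_sets add: N(2))
  have nm: "natext f \<in> measurable N (restrict_space borel ?S)"
    using natext_measurable by (simp cong: measurable_cong_sets add: N(2))
  have fr: "f \<in> measurable (restrict_space borel X) (restrict_space borel X)"
    by (rule measurable_restrict_space3[OF f]) (use f_X in auto)
  have marg: "distr (distr N (restrict_space borel ?S) (natext f)) (restrict_space borel X) (\<lambda>x. x n) = \<nu>" for n
  proof (cases n)
    case 0
    have "distr (distr N (restrict_space borel ?S) (natext f)) (restrict_space borel X) (\<lambda>x. x n)
        = distr N (restrict_space borel X) (f \<circ> (\<lambda>x. x 0))"
      by (simp add: distr_distr[OF coordinate_measurable nm] comp_def natext_def 0)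
    also have "\<dots> = \<nu>" using distr_distr[OF fr cm, of 0] by (simp add: N(3) inv_\<nu>)
    finally show ?thesis .
  next
    case (Suc m)
    then show ?thesis
      using N(3)[of m] by (simp add: distr_distr[OF coordinate_measurable nm] comp_def natext_def)
  qed
  have inv: "distr N (restrict_space borel ?S) (natext f) = N"
    by (rule invlim_measure_unique[OF prob_space.prob_space_distr[OF N(1) nm] sets_distr marg N])
  have "natext_measure X f \<nu> = N"
    unfolding natext_measure_def
  proof (rule the_equality)
    fix N' assume "prob_space N' \<and> sets N' = sets (restrict_space borel ?S) \<and>
      distr N' (restrict_space borel ?S) (natext f) = N' \<and> (\<forall>n. distr N' (restrict_space borel X) (\<lambda>x. x n) = \<nu>)"
    then show "N' = N" using N by (intro invlim_measure_unique) auto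
  qed (use N inv in auto)
  then show "prob_space (natext_measure X f \<nu>)"
    "sets (natext_measure X f \<nu>) = sets (restrict_space borel (invlim X f))"
    "distr (natext_measure X f \<nu>) (restrict_space borel X) (\<lambda>x. x n) = \<nu>"
    using N by auto
qed

end

section \<open>Weak continuity on the fat inverse limit\<close>

lemma tendsto_fun_coordinatewise:
  fixes f :: "'a \<Rightarrow> 'b \<Rightarrow> 'c::topological_space"
  assumes "\<And>i. ((\<lambda>c. f c i) \<longlongrightarrow> l i) F" shows "(f \<longlongrightarrow> l) F"
  using assms limitin_componentwise[of "\<lambda>_. euclidean" UNIV f l F]
  by (simp add: euclidean_product_topology limitin_canonical_iff)

text \<open>The inverse of the decreasing branch, which maps \<open>[turn t, 1]\<close> onto all of
  \<open>II\<close> for every slope and so yields preimages depending continuously on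
  \<open>t\<close>.\<close>

definition branch_inv :: "real \<Rightarrow> real \<Rightarrow> real" where
  "branch_inv t y = 1 - (y + 1) / t"

text \<open>A full orbit of \<open>tent t\<close> with \<open>y\<close> at position \<open>n\<close>, continued backwards along the
  surjective branch.\<close>

definition through_orbit :: "real \<Rightarrow> nat \<Rightarrow> real \<Rightarrow> nat \<Rightarrow> real" where
  "through_orbit t n y k = (if k \<le> n then (tent t ^^ (n - k)) y else (branch_inv t ^^ (k - n)) y)"

lemma branch_inv:
  assumes t: "t \<in> JJ" and y: "y \<in> II"
  shows "branch_inv t y \<in> II" "tent t (branch_inv t y) = y"
proof -
  have t1: "1 < t" "t \<le> 2" using JJ_D[OF t] by auto
  have y1: "- 1 \<le> y" "y \<le> 1" using y by (auto simp: II_def)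
  have "(y + 1) / t \<le> 2 / t" using t1 y1 by (intro divide_right_mono) auto
  then have turn: "turn t \<le> branch_inv t y" by (simp add: branch_inv_def turn_def)
  then show "tent t (branch_inv t y) = y" using t1 by (simp add: tent_right) (simp add: branch_inv_def)
  have "0 \<le> (y + 1) / t" using t1 y1 by simp
  then show "branch_inv t y \<in> II"
    using turn turn_ge_m1[OF t] by (auto simp: II_def branch_inv_def)
qed

lemma through_orbit_in_invlim:
  assumes t: "t \<in> JJ" and y: "y \<in> II" shows "through_orbit t n y \<in> invlim II (tent t)"
proof -
  have pre: "(branch_inv t ^^ k) y \<in> II" for k by (induction k) (auto simp: y branch_inv(1)[OF t])
  have "tent t (through_orbit t n y (Suc k)) = through_orbit t n y k" for k
  proof (cases "k < n")
    case True
    then have "n - k = Suc (n - Suc k)" by simp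
    then show ?thesis using True by (simp add: through_orbit_def)
  next
    case False
    then have "Suc k - n = Suc (k - n)" by simp
    then show ?thesis using False branch_inv(2)[OF t pre] by (auto simp: through_orbit_def)
  qed
  then show ?thesis using pre funpow_in_II[OF t y] by (simp add: invlim_def through_orbit_def)
qed

lemma through_orbit_agrees:
  assumes "x \<in> invlim II (tent t)" "k \<le> n" shows "through_orbit t n (x n) k = x k"
proof -
  have "(tent t ^^ j) (x (j + k)) = x k" for j
  proof (induction j)
    case (Suc j)
    have "tent t (x (Suc (j + k))) = x (j + k)" using assms(1) by (simp add: invlim_def)
    then show ?case using Suc by (simp add: funpow_swap1)
  qed simp
  from this[of "n - k"] show ?thesis using assms(2) by (simp add: through_orbit_def)
qed

lemma iota_in_Phat:
  assumes "t \<in> JJ" "x \<in> invlim II (tent t)" shows "iota t x \<in> Phat"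
  using assms by (auto simp: Phat_def invlim_def iota_def PP_def FF_def)

text \<open>Continuity in the slope and the base point together; it turns a continuous observable on
  \<open>Phat\<close> into observables on \<open>II\<close> to which \<open>acim_tendsto\<close>
  applies.\<close>

lemma tendsto_through_orbit:
  assumes "(\<tau> \<longlongrightarrow> t) F" "(\<xi> \<longlongrightarrow> x) F" "t \<noteq> 0"
  shows "((\<lambda>i. iota (\<tau> i) (through_orbit (\<tau> i) n (\<xi> i))) \<longlongrightarrow> iota t (through_orbit t n x)) F"
proof (rule tendsto_fun_coordinatewise)
  fix k
  have "((\<lambda>i. (branch_inv (\<tau> i) ^^ j) (\<xi> i)) \<longlongrightarrow> (branch_inv t ^^ j) x) F" for j
  proof (induction j)
    case (Suc j)
    then show ?case unfolding funpow.simps comp_apply branch_inv_def by (intro tendsto_intros assms)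
  qed (simp add: assms)
  then have "((\<lambda>i. through_orbit (\<tau> i) n (\<xi> i) k) \<longlongrightarrow> through_orbit t n x k) F"
    unfolding through_orbit_def using tendsto_funpow_tent[OF assms(1,2)] by simp
  then show "((\<lambda>i. iota (\<tau> i) (through_orbit (\<tau> i) n (\<xi> i)) k) \<longlongrightarrow> iota t (through_orbit t n x) k) F"
    unfolding iota_def by (intro tendsto_Pair assms)
qed

text \<open>\<open>Phat\<close> is not compact, as \<open>JJ\<close> is not closed. Over a compact
  set of slopes, Tychonoff's theorem gives a compact box, and the orbit relations are closed
  conditions.\<close>

lemma compact_Phat_slab:
  assumes "compact K" "K \<subseteq> JJ" shows "compact {x \<in> Phat. \<forall>n. x n \<in> II \<times> K}"
proof -
  let ?B = "Pi\<^sub>E UNIV (\<lambda>_::nat. II \<times> K)"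
  have "compactin (product_topology (\<lambda>_. euclidean) UNIV) ?B"
    unfolding compactin_PiE using assms by (simp add: II_def compact_Times)
  then have "compact ?B" by (simp add: euclidean_product_topology)
  moreover have "closed {x :: nat \<Rightarrow> real \<times> real. \<forall>n. FF (x (Suc n)) = x n}"
    unfolding FF_def tent_def
    by (intro closed_Collect_all closed_Collect_eq continuous_intros continuous_on_product_coordinates)
  ultimately have "compact (?B \<inter> {x. \<forall>n. FF (x (Suc n)) = x n})" by (rule compact_Int_closed)
  also have "?B \<inter> {x. \<forall>n. FF (x (Suc n)) = x n} = {x \<in> Phat. \<forall>n. x n \<in> II \<times> K}"
  proof -
    have "II \<times> K \<subseteq> PP" using assms(2) by (auto simp: PP_def)
    then show ?thesis unfolding Phat_def invlim_def PiE_UNIV_domain by blast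
  qed
  finally show ?thesis .
qed

text \<open>Uniform continuity on the compact slab, for a product metric in which all but finitely
  many coordinates together contribute at most \<open>(1 / 2) ^ m\<close>.\<close>

lemma continuous_on_Phat_finitary:
  assumes K: "compact K" "K \<subseteq> JJ" and \<alpha>: "continuous_on Phat \<alpha>" and e: "0 < (e::real)"
  obtains n where "\<And>t x y. t \<in> K \<Longrightarrow> x \<in> invlim II (tent t) \<Longrightarrow> y \<in> invlim II (tent t) \<Longrightarrow>
    (\<And>k. k \<le> n \<Longrightarrow> x k = y k) \<Longrightarrow> dist (\<alpha> (iota t x)) (\<alpha> (iota t y)) < e"
proof -
  let ?Q = "{x \<in> Phat. \<forall>n. x n \<in> II \<times> K}"
  have "uniformly_continuous_on ?Q \<alpha>"
    using \<alpha> by (intro compact_uniformly_continuous compact_Phat_slab K) (auto elim: continuous_on_subset)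
  then obtain d where d: "0 < d" "\<And>x y. x \<in> ?Q \<Longrightarrow> y \<in> ?Q \<Longrightarrow> dist y x < d \<Longrightarrow> dist (\<alpha> y) (\<alpha> x) < e"
    using e by (rule uniformly_continuous_onE) blast
  obtain m where m: "(1 / 2) ^ m < d" using real_arch_pow_inv[OF d(1), of "1 / 2"] by auto
  \<comment> \<open>The product metric enumerates the coordinates through \<open>from_nat\<close>,
    so \<open>n\<close> is the largest index among the first \<open>m + 1\<close> of the
    enumeration.\<close>
  define n where "n = Max (from_nat ` {..m} :: nat set)"
  show ?thesis
  proof (rule that[of n])
    fix t x y assume t: "t \<in> K" and xy: "x \<in> invlim II (tent t)" "y \<in> invlim II (tent t)"
      and eq: "\<And>k. k \<le> n \<Longrightarrow> x k = y k"
    have Q: "iota t x \<in> ?Q" "iota t y \<in> ?Q"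
      using t K xy iota_in_Phat[of t] by (auto simp: iota_def invlim_def)
    have "from_nat i \<le> n" if "i \<le> m" for i unfolding n_def using that by (intro Max_ge) auto
    then have "dist (iota t x (from_nat i)) (iota t y (from_nat i)) = 0" if "i \<le> m" for i
      using eq that by (simp add: iota_def)
    then have "{dist (iota t x (from_nat i)) (iota t y (from_nat i)) |i. i \<le> m} = {0}"
      by (intro equalityI subsetI) (use le0 in \<open>fastforce+\<close>)
    then have "dist (iota t x) (iota t y) \<le> (1 / 2) ^ m"
      using dist_fun_le_dist_first_terms[of "iota t x" "iota t y" m] by simp
    then show "dist (\<alpha> (iota t x)) (\<alpha> (iota t y)) < e" using d(2)[OF Q(2,1)] m by simp
  qed
qed

section \<open>Transfer of integrals from the fat inverse limit to the interval\<close>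

context
  fixes t :: real assumes t: "t \<in> JJ"
begin

lemma natext_tent:
  shows "prob_space (natext_measure II (tent t) (acim t))"
    "sets (natext_measure II (tent t) (acim t)) = sets (restrict_space borel (invlim II (tent t)))"
    "distr (natext_measure II (tent t) (acim t)) (restrict_space borel II) (\<lambda>x. x n) = acim t"
proof -
  have "prob_space (acim t)" "sets (acim t) = sets (restrict_space borel II)"
    "distr (acim t) (restrict_space borel II) (tent t) = acim t"
    using is_acim_acim[OF t] by (auto simp: is_acim_def)
  note * = natext_measure_characterization[OF II_sets tent_measurable tent_in_II[OF t] this]
  show "prob_space (natext_measure II (tent t) (acim t))"
    "sets (natext_measure II (tent t) (acim t)) = sets (restrict_space borel (invlim II (tent t)))"
    "distr (natext_measure II (tent t) (acim t)) (restrict_space borel II) (\<lambda>x. x n) = acim t"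
    by (rule *; assumption)+
qed

lemma space_natext_tent: "space (natext_measure II (tent t) (acim t)) = invlim II (tent t)"
  using sets_eq_imp_space_eq[OF natext_tent(2)] by (simp add: space_restrict_space)

lemma iota_measurable:
  "iota t \<in> measurable (natext_measure II (tent t) (acim t)) (restrict_space borel Phat)"
proof -
  have "iota t \<in> measurable borel borel"
    unfolding iota_def[abs_def]
    by (intro measurable_coordinatewise_then_product borel_measurable_Pair measurable_product_coordinates) simp
  then have "iota t \<in> measurable (restrict_space borel (invlim II (tent t))) (restrict_space borel Phat)"
    using iota_in_Phat[OF t] by (intro measurable_restrict_space3) auto
  then show ?thesis by (simp cong: measurable_cong_sets add: natext_tent(2))
qed

lemma coordinate_measurable_natext:
  "(\<lambda>x. x n) \<in> measurable (natext_measure II (tent t) (acim t)) (restrict_space borel II)"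
proof -
  have "(\<lambda>x. x n) \<in> measurable (restrict_space borel (invlim II (tent t))) (restrict_space borel II)"
    by (rule measurable_restrict_space3[OF measurable_product_coordinates]) (auto simp: invlim_def)
  then show ?thesis by (simp cong: measurable_cong_sets add: natext_tent(2))
qed

text \<open>Both integrals pull back to the natural extension, a probability space on which the
  integrands differ by at most \<open>e\<close> pointwise.\<close>

lemma muhat_tilde_approx:
  assumes \<alpha>: "continuous_on Phat \<alpha>" and \<beta>: "bdd_borel M \<beta>"
    and bound: "\<And>x. x \<in> invlim II (tent t) \<Longrightarrow> \<bar>\<alpha> (iota t x)\<bar> \<le> M"
    and close: "\<And>x. x \<in> invlim II (tent t) \<Longrightarrow> \<bar>\<alpha> (iota t x) - \<beta> (x n)\<bar> \<le> e"
  shows "\<bar>(\<integral>x. \<alpha> x \<partial>muhat_tilde t) - (\<integral>x. \<beta> x \<partial>acim t)\<bar> \<le> e"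
proof -
  let ?N = "natext_measure II (tent t) (acim t)"
  interpret N: prob_space ?N by (rule natext_tent(1))
  have \<alpha>m: "\<alpha> \<in> borel_measurable (restrict_space borel Phat)"
    by (rule borel_measurable_continuous_on_restrict[OF \<alpha>])
  have \<beta>m: "\<beta> \<in> borel_measurable (restrict_space borel II)"
    using bdd_borelD(1)[OF \<beta>] by (rule measurable_restrict_space1)
  have 1: "(\<integral>x. \<alpha> x \<partial>muhat_tilde t) = (\<integral>x. \<alpha> (iota t x) \<partial>?N)"
    unfolding muhat_tilde_def by (rule integral_distr[OF iota_measurable \<alpha>m])
  have "(\<integral>x. \<beta> x \<partial>acim t) = (\<integral>x. \<beta> x \<partial>distr ?N (restrict_space borel II) (\<lambda>x. x n))"
    by (simp add: natext_tent(3))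
  also have "\<dots> = (\<integral>x. \<beta> (x n) \<partial>?N)" by (rule integral_distr[OF coordinate_measurable_natext \<beta>m])
  finally have 2: "(\<integral>x. \<beta> x \<partial>acim t) = (\<integral>x. \<beta> (x n) \<partial>?N)" .
  have i1: "integrable ?N (\<lambda>x. \<alpha> (iota t x))"
    using bound measurable_compose[OF iota_measurable \<alpha>m]
    by (intro N.integrable_const_bound[of _ M]) (auto simp: space_natext_tent)
  have i2: "integrable ?N (\<lambda>x. \<beta> (x n))"
    using bdd_borelD(2)[OF \<beta>] measurable_compose[OF coordinate_measurable_natext \<beta>m]
    by (intro N.integrable_const_bound[of _ M]) auto
  have "\<bar>(\<integral>x. \<alpha> (iota t x) \<partial>?N) - (\<integral>x. \<beta> (x n) \<partial>?N)\<bar> = \<bar>\<integral>x. \<alpha> (iota t x) - \<beta> (x n) \<partial>?N\<bar>"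
    using i1 i2 by simp
  also have "\<dots> \<le> (\<integral>x. \<bar>\<alpha> (iota t x) - \<beta> (x n)\<bar> \<partial>?N)" by (rule integral_abs_bound)
  also have "\<dots> \<le> (\<integral>x. e \<partial>?N)"
    using i1 i2 close by (intro integral_mono) (auto simp: space_natext_tent)
  also have "\<dots> = e" using N.prob_space by simp
  finally show ?thesis unfolding 1 2 .
qed

end

theorem mainTheorem3:
  fixes ts :: "nat \<Rightarrow> real" and tstar :: real
    and \<alpha> :: "(nat \<Rightarrow> real \<times> real) \<Rightarrow> real"
  assumes "\<forall>i. ts i \<in> JJ" and "tstar \<in> JJ" and "ts \<longlonglongrightarrow> tstar"
    and "continuous_on Phat \<alpha>"
  shows "(\<lambda>i. \<integral>x. \<alpha> x \<partial>muhat_tilde (ts i)) \<longlonglongrightarrow> (\<integral>x. \<alpha> x \<partial>muhat_tilde tstar)"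
proof (rule metric_LIMSEQ_I)
  fix e :: real assume e: "0 < e"
  \<comment> \<open>A convergent sequence together with its limit is compact; over these slopes
    \<open>\<alpha>\<close> is bounded and uniformly continuous, although it may be unbounded on
    \<open>Phat\<close>.\<close>
  define K where "K = insert tstar (range ts)"
  have K: "compact K" "K \<subseteq> JJ"
    using compact_sequence_with_limit[OF assms(3)] assms(1,2) by (auto simp: K_def)
  let ?Q = "{x \<in> Phat. \<forall>n. x n \<in> II \<times> K}"
  have "compact (\<alpha> ` ?Q)"
    by (intro compact_continuous_image compact_Phat_slab K continuous_on_subset[OF assms(4)]) auto
  then obtain M where M: "\<And>x. x \<in> ?Q \<Longrightarrow> \<bar>\<alpha> x\<bar> \<le> M"
    using compact_imp_bounded[of "\<alpha> ` ?Q"] by (auto simp: bounded_iff)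
  have bound: "\<bar>\<alpha> (iota t x)\<bar> \<le> M" if "t \<in> K" "x \<in> invlim II (tent t)" for t x
  proof (rule M)
    have "iota t x \<in> Phat" using that K by (intro iota_in_Phat) auto
    then show "iota t x \<in> ?Q" using that by (auto simp: iota_def invlim_def)
  qed
  obtain n where n: "\<And>t x y. t \<in> K \<Longrightarrow> x \<in> invlim II (tent t) \<Longrightarrow> y \<in> invlim II (tent t) \<Longrightarrow>
    (\<And>k. k \<le> n \<Longrightarrow> x k = y k) \<Longrightarrow> dist (\<alpha> (iota t x)) (\<alpha> (iota t y)) < e / 3"
    using continuous_on_Phat_finitary[OF K assms(4), of "e / 3"] e by auto
  \<comment> \<open>An orbit is replaced by the canonical one through its \<open>n\<close>-th
    coordinate, which leaves a function of one real variable. The indicator extends it by 0 to the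
    line, where \<open>bdd_borel\<close> asks for the bound.\<close>
  define \<beta> where "\<beta> t y = indicator II y * \<alpha> (iota t (through_orbit t n y))" for t y
  have lim: "(\<lambda>i. \<beta> (\<tau> i) (\<xi> i)) \<longlonglongrightarrow> \<beta> t y"
    if "\<tau> \<longlonglongrightarrow> t" "\<And>i. \<tau> i \<in> JJ" "t \<in> JJ" "y \<in> II" "\<And>i. \<xi> i \<in> II" "\<xi> \<longlonglongrightarrow> y" for \<tau> \<xi> t y
  proof -
    have "(\<lambda>i. \<alpha> (iota (\<tau> i) (through_orbit (\<tau> i) n (\<xi> i)))) \<longlonglongrightarrow> \<alpha> (iota t (through_orbit t n y))"
      using that JJ_D[OF that(3)]
      by (intro continuous_on_tendsto_compose[OF assms(4)] tendsto_through_orbit always_eventually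
          iota_in_Phat through_orbit_in_invlim allI) auto
    then show ?thesis using that by (simp add: \<beta>_def)
  qed
  have \<beta>: "bdd_borel M (\<beta> t)" if t: "t \<in> K" for t
  proof -
    have tJ: "t \<in> JJ" using t K by auto
    \<comment> \<open>A constant sequence of slopes in \<open>lim\<close> gives continuity in the
      point alone, and from it measurability.\<close>
    have "continuous_on II (\<beta> t)"
      using lim[OF tendsto_const tJ tJ] by (intro continuous_on_sequentiallyI) auto
    from borel_measurable_continuous_on_indicator[OF II_sets this]
    have "\<beta> t \<in> borel_measurable borel" by (simp add: \<beta>_def[abs_def] mult.assoc[symmetric] flip: indicator_inter_arith)
    moreover have "0 \<le> M" using bound[OF t through_orbit_in_invlim[OF tJ one_in_II]] abs_ge_zero order.trans by blast
    then have "\<bar>\<beta> t y\<bar> \<le> M" for y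
      using bound[OF t through_orbit_in_invlim[OF tJ]] by (auto simp: \<beta>_def indicator_def)
    ultimately show ?thesis by (simp add: bdd_borel_def)
  qed
  have approx: "\<bar>(\<integral>x. \<alpha> x \<partial>muhat_tilde t) - (\<integral>x. \<beta> t x \<partial>acim t)\<bar> \<le> e / 3" if t: "t \<in> K" for t
  proof (rule muhat_tilde_approx[OF _ assms(4) \<beta>[OF t] bound[OF t]])
    show tJ: "t \<in> JJ" using t K by auto
    fix x assume x: "x \<in> invlim II (tent t)"
    then have "x n \<in> II" by (simp add: invlim_def)
    \<comment> \<open>The orbit \<open>x\<close> and the canonical orbit through \<open>x n\<close>
      agree in all coordinates up to \<open>n\<close>.\<close>
    then show "\<bar>\<alpha> (iota t x) - \<beta> t (x n)\<bar> \<le> e / 3"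
      using n[OF t x through_orbit_in_invlim[OF tJ]] through_orbit_agrees[OF x]
      by (simp add: \<beta>_def dist_real_def less_imp_le)
  qed
  have tsK: "ts i \<in> K" "tstar \<in> K" and tsJ: "ts i \<in> JJ" for i using assms(1) by (auto simp: K_def)
  have "(\<lambda>i. \<integral>x. \<beta> (ts i) x \<partial>acim (ts i)) \<longlonglongrightarrow> (\<integral>x. \<beta> tstar x \<partial>acim tstar)"
    by (rule acim_tendsto[OF lim[OF assms(3) tsJ assms(2)] tsJ assms(2,3) \<beta>[OF tsK(1)] \<beta>[OF tsK(2)]])
  from metric_LIMSEQ_D[OF this, of "e / 3"] e obtain i0 where
    i0: "\<And>i. i0 \<le> i \<Longrightarrow> dist (\<integral>x. \<beta> (ts i) x \<partial>acim (ts i)) (\<integral>x. \<beta> tstar x \<partial>acim tstar) < e / 3"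
    by auto
  have tri: "dist a d < e" if "\<bar>a - b\<bar> \<le> e / 3" "\<bar>d - c\<bar> \<le> e / 3" "dist b c < e / 3" for a b c d :: real
    using that unfolding dist_real_def by linarith
  have "dist (\<integral>x. \<alpha> x \<partial>muhat_tilde (ts i)) (\<integral>x. \<alpha> x \<partial>muhat_tilde tstar) < e" if "i0 \<le> i" for i
    by (rule tri[OF approx[OF tsK(1)] approx[OF tsK(2)] i0[OF that]])
  then show "\<exists>i0. \<forall>i\<ge>i0. dist (\<integral>x. \<alpha> x \<partial>muhat_tilde (ts i)) (\<integral>x. \<alpha> x \<partial>muhat_tilde tstar) < e" by blast
qed

end
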